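(* Let $X$ and $Y$ be random matrices in $\mathbb{R}^{N\times p}$ ($Np\ge2$) with $X\sim N(\mu,\Sigma^X)$ and $Y\sim N(\mu,\Sigma^Y)$. Define $T=\min_{k\in[N]}\max_{j\in[p]}X_{kj}$ and $\widetilde T=\min_{k\in[N]}\max_{j\in[p]}Y_{kj}$. Then for any $\delta>0$ and Borel set $A\subseteq\mathbb{R}$, $$P(T\in A)\le P(\widetilde T\in A^{5\delta})+C\delta^{-2}\|\Sigma^X-\Sigma^Y\|_\infty\log(Np),$$ where $\|\Sigma^Y-\Sigma^X\|_\infty=\max_{k_1,k_2\in[N],\,j_1,j_2\in[p]}|\Sigma^Y_{(k_1j_1,k_2j_2)}-\Sigma^X_{(k_1j_1,k_2j_2)}|$ and $C>0$ is a universal constant.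
   Context: $\Sigma^X_{(k_1j_1,k_2j_2)}=\mathrm{cov}(X_{k_1j_1},X_{k_2j_2})$ (similarly for $Y$); $\mu\in\mathbb{R}^{N\times p}$ is the common mean. For a Borel $A\subseteq\mathbb{R}$ and $\epsilon>0$, $A^\epsilon=\{t\in\mathbb{R}:\mathrm{dist}(t,A)\le\epsilon\}$. *)

theory Defs
  imports "HOL-Probability.Probability"
begin

definition mat_idx :: "nat \<Rightarrow> nat \<Rightarrow> (nat \<times> nat) set" where
  "mat_idx N p = {..<N} \<times> {..<p}"

definition gaussian_law ::
  "'i set \<Rightarrow> ('i \<Rightarrow> real) measure \<Rightarrow> ('i \<Rightarrow> real) \<Rightarrow> ('i \<Rightarrow> 'i \<Rightarrow> real) \<Rightarrow> bool" where
  "gaussian_law I P mu S \<longleftrightarrow>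
     prob_space P \<and> sets P = sets (PiM I (\<lambda>_. borel)) \<and>
     (\<forall>i\<in>I. \<forall>j\<in>I. S i j = S j i) \<and>
     (\<forall>a :: 'i \<Rightarrow> real.
        (let m = (\<Sum>i\<in>I. a i * mu i);
             v = (\<Sum>i\<in>I. \<Sum>j\<in>I. a i * a j * S i j)
         in v \<ge> 0 \<and>
            distr P borel (\<lambda>x. \<Sum>i\<in>I. a i * x i) =
              (if v = 0 then return borel m else density lborel (normal_density m (sqrt v)))))"

definition minmax_stat :: "nat \<Rightarrow> nat \<Rightarrow> ((nat \<times> nat) \<Rightarrow> real) \<Rightarrow> real" where
  "minmax_stat N p x = Min ((\<lambda>k. Max ((\<lambda>j. x (k, j)) ` {..<p})) ` {..<N})"

text \<open>A^eps = {t. dist(t,A) <= eps}; empty for A empty (dist to the empty set is +infinity).\<close>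
definition enlarge :: "real set \<Rightarrow> real \<Rightarrow> real set" where
  "enlarge A eps = {t. A \<noteq> {} \<and> infdist t A \<le> eps}"

definition cov_sup_dist :: "nat \<Rightarrow> nat \<Rightarrow> ((nat \<times> nat) \<Rightarrow> (nat \<times> nat) \<Rightarrow> real)
    \<Rightarrow> ((nat \<times> nat) \<Rightarrow> (nat \<times> nat) \<Rightarrow> real) \<Rightarrow> real" where
  "cov_sup_dist N p S1 S2 =
     Max ((\<lambda>(u, w). \<bar>S1 u w - S2 u w\<bar>) ` (mat_idx N p \<times> mat_idx N p))"

end

theory Submission
  imports Defs
begin

text \<open>The statistic \<open>T\<close> is replaced by \<open>F (x) = - log (\<Sum>\<^sub>k 1 / \<Sum>\<^sub>j exp (\<beta> x\<^sub>k\<^sub>j)) / \<beta>\<close> with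
  \<open>\<beta> = log (N p) / \<delta>\<close>, which is within \<open>\<delta>\<close> of \<open>T\<close>, and the indicator of \<open>A\<close> by a smooth cutoff \<open>g\<close>
  between \<open>A\<^sup>\<delta>\<close> and \<open>A\<^sup>4\<^sup>\<delta>\<close>. The entries of the Hessian of \<open>g \<circ> F\<close> have absolute sum at most
  \<open>\<bar>g''\<bar> + 4 \<beta> \<bar>g'\<bar> = O (log (N p) / \<delta>\<^sup>2)\<close>. Hence, by a Lindeberg replacement of small Gaussian
  increments, the expectations of \<open>g \<circ> F\<close> under the two laws differ by at most this bound times half
  the distance of the covariances. Since a Gaussian law is given only through its one-dimensional
  projections, the replacement argument rests on the theorem that these determine the joint law.\<close>

section \<open>Measures on finite products are determined by their projections\<close>

text \<open>The covariances may be singular, so neither law need have a density, and only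
  one-dimensional projections are described. Replacement suits this: of an increment it uses only
  the mean, the covariance and a finite third absolute moment. The cubic Taylor remainder may depend
  on N and p in any way, since over n steps it adds up to order n^(-1/2) and disappears in the
  limit. What survives is the absolute sum of the Hessian entries. It is free of the dimension
  because the derivatives of \<open>F\<close> are moments under probability weights, one family
  within each row and one across the rows. The radius 5 \<delta> is spent as follows: if T lies in
  A, then \<open>F\<close> is within \<delta> of A, where the cutoff is 1; where the cutoff is
  nonzero, \<open>F\<close> is within 4 \<delta> of A, so T is within 5 \<delta>. The cutoff needs a
  gap of 3 \<delta>: one \<delta> for its linear slope and one on either side for the
  averaging.\<close>

lemma finite_measure_density_bounded:
  fixes g :: "'a \<Rightarrow> real"
  assumes "finite_measure M" and [measurable]: "g \<in> borel_measurable M"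
    and "\<And>x. g x \<le> B" "\<And>x. 0 \<le> g x"
  shows "finite_measure (density M g)"
proof
  interpret finite_measure M by fact
  have "emeasure (density M g) (space M) = (\<integral>\<^sup>+ x. g x * indicator (space M) x \<partial>M)"
    by (subst emeasure_density) (auto intro!: nn_integral_cong simp: indicator_def)
  also have "\<dots> \<le> (\<integral>\<^sup>+ x. ennreal B \<partial>M)"
    using assms by (intro nn_integral_mono) (auto simp: indicator_def intro!: ennreal_leI)
  also have "\<dots> = ennreal B * emeasure M (space M)" by simp
  also have "\<dots> < \<infinity>"
    by (simp add: ennreal_mult_less_top emeasure_eq_measure)
  finally show "emeasure (density M g) (space (density M g)) \<noteq> \<infinity>" by simp
qed

lemma real_measure_eqI_cos:
  fixes M N :: "real measure"
  assumes M: "finite_measure M" "sets M = sets borel"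
    and N: "finite_measure N" "sets N = sets borel"
    and eq: "\<And>t c. (\<integral>x. cos (t * x + c) \<partial>M) = (\<integral>x. cos (t * x + c) \<partial>N)"
  shows "M = N"
proof -
  interpret M: finite_measure M by fact
  interpret N: finite_measure N by fact
  note [measurable_cong] = M(2) N(2)
  have sp: "space M = UNIV" "space N = UNIV"
    using sets_eq_imp_space_eq[OF M(2)] sets_eq_imp_space_eq[OF N(2)] by auto
  have m: "measure M UNIV = measure N UNIV"
    using eq[of 0 0] by (simp add: sp)
  show ?thesis
  proof (cases "measure M UNIV = 0")
    case True
    have "emeasure M A = 0" "emeasure N A = 0" for A
      using M.bounded_measure[of A] N.bounded_measure[of A] True m
      by (auto simp: M.emeasure_eq_measure N.emeasure_eq_measure sp measure_le_0_iff)
    then show ?thesis using M(2) N(2) by (intro measure_eqI) auto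
  next
    case False
    define r where "r = 1 / measure M UNIV"
    have r: "r > 0" using False by (simp add: r_def less_le)
    define D where "D L = density L (\<lambda>_::real. ennreal r)" for L
    have *: "real_distribution (D L) \<and> char (D L) t = 
        Complex (r * (\<integral>x. cos (t * x + 0) \<partial>L)) (r * (\<integral>x. cos (t * x + - (pi/2)) \<partial>L))"
      if L: "finite_measure L" "sets L = sets borel" "measure L UNIV = measure M UNIV" for L t
    proof -
      interpret L: finite_measure L by fact
      note [measurable_cong] = L(2)
      have spL: "space L = UNIV" using sets_eq_imp_space_eq[OF L(2)] by auto
      have e: "emeasure (D L) (space (D L)) = 1"
        unfolding D_def using r False
        by (subst emeasure_density)
           (auto simp: spL nn_integral_cmult L.emeasure_eq_measure L(3) r_def ennreal_mult[symmetric])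
      have rD: "real_distribution (D L)"
        by (intro real_distribution.intro real_distribution_axioms.intro prob_spaceI[OF e])
           (simp add: D_def L(2))
      have i1: "integrable L (\<lambda>x. iexp (t * x))"
        by (intro L.integrable_const_bound[of _ 1]) auto
      have "char (D L) t = r *\<^sub>R (CLINT x|L. iexp (t * x))"
        unfolding char_def D_def using r by (subst integral_density) auto
      also have "\<dots> = Complex (r * (\<integral>x. cos (t * x) \<partial>L)) (r * (\<integral>x. sin (t * x) \<partial>L))"
        using integral_Re[OF i1] integral_Im[OF i1]
        by (intro complex_eqI) (simp_all add: Re_exp Im_exp)
      also have "(\<lambda>x. sin (t * x)) = (\<lambda>x. cos (t * x + - (pi/2)))"
        by (auto simp: cos_diff)
      finally show ?thesis using rD by simp
    qed
    have "D M = D N"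
    proof (rule Levy_uniqueness)
      show "char (D M) = char (D N)"
        using *[OF M refl] *[OF N m[symmetric]] by (intro ext) (simp only: eq)
    qed (use *[OF M refl] *[OF N m[symmetric]] in blast)+
    have "emeasure M A = emeasure N A" if "A \<in> sets M" for A
    proof -
      have [measurable]: "A \<in> sets borel" using that M by simp
      have "emeasure (D M) A = emeasure (D N) A" by (simp add: \<open>D M = D N\<close>)
      then show ?thesis
        using r unfolding D_def
        by (subst (asm) (1 2) emeasure_density)
           (auto simp: nn_integral_cmult ennreal_mult_cancel_left)
    qed
    then show ?thesis using M(2) N(2) by (intro measure_eqI) auto
  qed
qed

text \<open>One coordinate \<open>x\<^sub>i\<close> is split off by
  weighting the measures with the nonnegative densities \<open>1 + cos (a \<bullet> x' + c)\<close> of the remaining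
  coordinates, which reduces the claim to the one-dimensional theorem for \<open>x\<^sub>i\<close> and the induction
  hypothesis for \<open>x'\<close>.\<close>

theorem PiM_measure_eqI_cos:
  fixes M N :: "('i \<Rightarrow> real) measure"
  assumes "finite I"
    and "finite_measure M" "sets M = sets (PiM I (\<lambda>_. borel))"
    and "finite_measure N" "sets N = sets (PiM I (\<lambda>_. borel))"
    and "\<And>a c. (\<integral>x. cos ((\<Sum>i\<in>I. a i * x i) + c) \<partial>M) = (\<integral>x. cos ((\<Sum>i\<in>I. a i * x i) + c) \<partial>N)"
  shows "M = N"
  using assms
proof (induction I arbitrary: M N rule: finite_induct)
  case empty
  interpret M: finite_measure M by fact
  interpret N: finite_measure N by fact
  have "measure M (space M) = measure N (space N)"
    using empty(5)[of _ 0] by simp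
  moreover have "space M = space N"
    using empty by (metis sets_eq_imp_space_eq)
  moreover have "A = {} \<or> A = space M" if "A \<in> sets M" for A
    using that sets.sets_into_space[OF that] sets_eq_imp_space_eq[OF empty(2)] by (auto simp: space_PiM)
  ultimately have "measure M A = measure N A" if "A \<in> sets M" for A
    using that by force
  then show ?case
    using empty by (intro measure_eqI) (auto simp: M.emeasure_eq_measure N.emeasure_eq_measure)
next
  case (insert i I)
  note [measurable_cong] = insert(5,7)
  interpret M: finite_measure M by fact
  interpret N: finite_measure N by fact
  have sp: "space M = space N"
    using insert(5,7) by (metis sets_eq_imp_space_eq)
  define \<theta> where "\<theta> a x = (\<Sum>i\<in>I. a i * x i)" for a x :: "'i \<Rightarrow> real"
  have [measurable]: "\<theta> a \<in> borel_measurable (PiM (insert i I) (\<lambda>_. borel))" for a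
    unfolding \<theta>_def by measurable
  have ci: "integrable L (\<lambda>x. cos (t * x i + \<theta> a x + c))"
    if "finite_measure L" and [measurable_cong]: "sets L = sets (PiM (insert i I) (\<lambda>_. borel))" for L t a c
  proof -
    interpret L: finite_measure L by fact
    show ?thesis by (intro L.integrable_const_bound[of _ 1]) auto
  qed
  have eq: "(\<integral>x. cos (t * x i + \<theta> a x + c) \<partial>M) = (\<integral>x. cos (t * x i + \<theta> a x + c) \<partial>N)" for t a c
  proof -
    have *: "(\<Sum>j\<in>insert i I. (a(i:=t)) j * x j) + c = t * x i + \<theta> a x + c" for x :: "'i \<Rightarrow> real"
      using insert(1,2) by (auto simp: \<theta>_def intro!: sum.cong)
    show ?thesis using insert(8)[of "a(i:=t)" c] unfolding * .
  qed
  define w where "w a c x = 1 + cos (\<theta> a x + c)" for a c x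
  have [measurable]: "w a c \<in> borel_measurable (PiM (insert i I) (\<lambda>_. borel))" for a c
    unfolding w_def by measurable
  have wb: "0 \<le> w a c x" "w a c x \<le> 2" for a c x
    unfolding w_def using cos_ge_minus_one[of "\<theta> a x + c"] cos_le_one[of "\<theta> a x + c"] by linarith+
  have push: "distr (density M (w a c)) borel (\<lambda>x. x i) = distr (density N (w a c)) borel (\<lambda>x. x i)" for a c
  proof (rule real_measure_eqI_cos)
    fix t d
    have "(\<integral>x. cos (t * x + d) \<partial>distr (density L (w a c)) borel (\<lambda>x. x i)) =
       (\<integral>x. cos (t * x i + \<theta> (\<lambda>_. 0) x + d) \<partial>L) + ((\<integral>x. cos (t * x i + \<theta> a x + (c + d)) \<partial>L)
         + (\<integral>x. cos (t * x i + \<theta> (\<lambda>i. - a i) x + (d - c)) \<partial>L)) / 2"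
      if L: "finite_measure L" and [measurable_cong]: "sets L = sets (PiM (insert i I) (\<lambda>_. borel))" for L
    proof -
      have "(\<integral>x. cos (t * x + d) \<partial>distr (density L (w a c)) borel (\<lambda>x. x i))
          = (\<integral>x. w a c x * cos (t * x i + d) \<partial>L)"
        using wb by (subst integral_distr) (auto simp: integral_density)
      \<comment> \<open>The product-to-sum formula turns the weighted cosine into cosines of linear
        forms in all coordinates, whose integrals agree by \<open>eq\<close>.\<close>
      also have "(\<lambda>x. w a c x * cos (t * x i + d)) = (\<lambda>x. cos (t * x i + \<theta> (\<lambda>_. 0) x + d) +
          (cos (t * x i + \<theta> a x + (c + d)) + cos (t * x i + \<theta> (\<lambda>i. - a i) x + (d - c))) / 2)"
      proof
        fix x :: "'i \<Rightarrow> real"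
        have "\<theta> (\<lambda>i. - a i) x = - \<theta> a x" "\<theta> (\<lambda>_. 0) x = 0" by (simp_all add: \<theta>_def sum_negf)
        then show "w a c x * cos (t * x i + d) = cos (t * x i + \<theta> (\<lambda>_. 0) x + d) +
          (cos (t * x i + \<theta> a x + (c + d)) + cos (t * x i + \<theta> (\<lambda>i. - a i) x + (d - c))) / 2"
          by (simp add: w_def distrib_right cos_times_cos algebra_simps)
             (metis cos_minus minus_diff_eq)
      qed
      finally show ?thesis using ci[OF L that(2)] by simp
    qed
    from this[OF insert(4,5)] this[OF insert(6,7)]
    show "(\<integral>x. cos (t * x + d) \<partial>distr (density M (w a c)) borel (\<lambda>x. x i))
        = (\<integral>x. cos (t * x + d) \<partial>distr (density N (w a c)) borel (\<lambda>x. x i))"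
      by (simp add: eq)
  next
    show "finite_measure (distr (density M (w a c)) borel (\<lambda>x. x i))"
         "finite_measure (distr (density N (w a c)) borel (\<lambda>x. x i))"
      using wb insert(4,6)
      by (auto intro!: finite_measure.finite_measure_distr finite_measure_density_bounded[where B=2])
  qed simp_all
  have half: "(\<integral>x. indicator B (x i) * cos (\<theta> a x + c) \<partial>M) = (\<integral>x. indicator B (x i) * cos (\<theta> a x + c) \<partial>N)"
    if [measurable]: "B \<in> sets borel" for a c and B :: "real set"
  proof -
    have 1: "(\<integral>x. w a c x * indicator B (x i) \<partial>M) = (\<integral>x. w a c x * indicator B (x i) \<partial>N)" for a c
    proof -
      have "(\<integral>x. indicator B x \<partial>distr (density L (w a c)) borel (\<lambda>x. x i)) = (\<integral>x. w a c x * indicator B (x i) \<partial>L)"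
        if [measurable_cong]: "sets L = sets (PiM (insert i I) (\<lambda>_. borel))" for L
        using wb by (subst integral_distr) (auto simp: integral_density simp del: integral_indicator)
      from this[OF insert(5)] this[OF insert(7)] push show ?thesis by simp
    qed
    \<comment> \<open>The weight for \<open>a = 0\<close> and \<open>c = 0\<close> is the constant
      2, so subtracting half of it removes the summand 1 of \<open>w a c\<close> and isolates the
      cosine.\<close>
    have "(\<integral>x. indicator B (x i) * cos (\<theta> a x + c) \<partial>L)
       = (\<integral>x. w a c x * indicator B (x i) \<partial>L) - (\<integral>x. w (\<lambda>_. 0) 0 x * indicator B (x i) \<partial>L) / 2" 
      if "finite_measure L" and [measurable_cong]: "sets L = sets (PiM (insert i I) (\<lambda>_. borel))" for L
    proof -
      interpret L: finite_measure L by fact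
      have [simp]: "integrable L (\<lambda>x. w a c x * indicator B (x i))" for a c
        by (intro L.integrable_const_bound[of _ 2])
           (use wb in \<open>auto simp: indicator_def\<close>)
      have "(\<lambda>x. indicator B (x i) * cos (\<theta> a x + c))
          = (\<lambda>x. w a c x * indicator B (x i) - w (\<lambda>_. 0) 0 x * indicator B (x i) / 2)"
        by (auto simp: w_def \<theta>_def algebra_simps)
      then show ?thesis by simp
    qed
    from this[OF insert(4,5)] this[OF insert(6,7)] show ?thesis by (simp add: 1)
  qed
  \<comment> \<open>Restricting \<open>L\<close> to the event that coordinate \<open>i\<close> lies
    in \<open>B\<close> and then forgetting this coordinate gives a measure to which the induction
    hypothesis applies; its values on boxes are those of \<open>L\<close> on boxes with side
    \<open>B\<close>.\<close>
  define R where "R L B = distr (density L (\<lambda>x. ennreal (indicator B (x i)))) (PiM I (\<lambda>_. borel)) (\<lambda>x. restrict x I)"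
    for L and B :: "real set"
  have [measurable]: "(\<lambda>x. restrict x I) \<in> measurable (PiM (insert i I) (\<lambda>_. borel)) (PiM I (\<lambda>_. borel))"
    by (rule measurable_restrict_subset) auto
  have R: "R M B = R N B" if [measurable]: "B \<in> sets borel" for B
  proof (rule insert(3))
    show "finite_measure (R M B)" "finite_measure (R N B)"
      unfolding R_def using insert(4,6)
      by (auto intro!: finite_measure.finite_measure_distr finite_measure_density_bounded[where B=1])
    fix a :: "'i \<Rightarrow> real" and c
    have "(\<integral>x. cos ((\<Sum>i\<in>I. a i * x i) + c) \<partial>R L B) = (\<integral>x. indicator B (x i) * cos (\<theta> a x + c) \<partial>L)"
      if [measurable_cong]: "sets L = sets (PiM (insert i I) (\<lambda>_. borel))" for L
      unfolding R_def
      by (subst integral_distr) (auto simp: integral_density \<theta>_def)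
    from this[OF insert(5)] this[OF insert(7)] half[OF that]
    show "(\<integral>x. cos ((\<Sum>i\<in>I. a i * x i) + c) \<partial>R M B) = (\<integral>x. cos ((\<Sum>i\<in>I. a i * x i) + c) \<partial>R N B)"
      by simp
  qed (simp_all add: R_def)
  show "M = N"
  proof (rule measure_eqI_PiM_finite[where I="insert i I" and M="\<lambda>_. borel" and A="\<lambda>_. Pi\<^sub>E (insert i I) (\<lambda>_. UNIV)"])
    fix A :: "'i \<Rightarrow> real set" assume "\<And>j. j \<in> insert i I \<Longrightarrow> A j \<in> sets borel"
    then have [measurable]: "A i \<in> sets borel" "Pi\<^sub>E I A \<in> sets (PiM I (\<lambda>_. borel))"
      and A': "Pi\<^sub>E (insert i I) A \<in> sets (PiM (insert i I) (\<lambda>_. borel))"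
      using insert(1) by auto
    have "emeasure (R L (A i)) (Pi\<^sub>E I A) = emeasure L (Pi\<^sub>E (insert i I) A)"
      if L[measurable_cong]: "sets L = sets (PiM (insert i I) (\<lambda>_. borel))" for L
    proof -
      have spL: "space L = Pi\<^sub>E (insert i I) (\<lambda>_. UNIV)"
        using sets_eq_imp_space_eq[OF L] by (simp add: space_PiM)
      have "(\<lambda>x. restrict x I) \<in> measurable L (PiM I (\<lambda>_. borel))" by measurable
      then have ms: "(\<lambda>x. restrict x I) -` Pi\<^sub>E I A \<inter> space L \<in> sets L"
        by (rule measurable_sets) measurable
      have "emeasure (R L (A i)) (Pi\<^sub>E I A)
          = emeasure (density L (\<lambda>x. ennreal (indicator (A i) (x i)))) ((\<lambda>x. restrict x I) -` Pi\<^sub>E I A \<inter> space L)"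
        unfolding R_def by (subst emeasure_distr) auto
      also have "\<dots> = (\<integral>\<^sup>+x. indicator (Pi\<^sub>E (insert i I) A) x \<partial>L)"
        by (subst emeasure_density[OF _ ms])
           (auto intro!: nn_integral_cong simp: spL indicator_def PiE_iff Pi_iff extensional_def fun_eq_iff)
      also have "\<dots> = emeasure L (Pi\<^sub>E (insert i I) A)"
        using A' L by (intro nn_integral_indicator) auto
      finally show ?thesis .
    qed
    from this[OF insert(5)] this[OF insert(7)] R[of "A i"]
    show "emeasure M (Pi\<^sub>E (insert i I) A) = emeasure N (Pi\<^sub>E (insert i I) A)" by simp
  next
    show "range (\<lambda>_::nat. Pi\<^sub>E (insert i I) (\<lambda>_. UNIV)) \<subseteq> prod_algebra (insert i I) (\<lambda>_. borel::real measure)"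
      using insert(1) by (auto intro!: prod_algebraI_finite)
  qed (use insert in \<open>auto simp: space_PiM M.emeasure_eq_measure\<close>)
qed

section \<open>Gaussian laws\<close>

abbreviation lin_form :: "'i set \<Rightarrow> ('i \<Rightarrow> real) \<Rightarrow> ('i \<Rightarrow> real) \<Rightarrow> real" where
  "lin_form I a x \<equiv> (\<Sum>i\<in>I. a i * x i)"

abbreviation quad_form :: "'i set \<Rightarrow> ('i \<Rightarrow> 'i \<Rightarrow> real) \<Rightarrow> ('i \<Rightarrow> real) \<Rightarrow> real" where
  "quad_form I S a \<equiv> (\<Sum>i\<in>I. \<Sum>j\<in>I. a i * a j * S i j)"

lemma distr_std_normal_affine:
  assumes "\<sigma> > 0"
  shows "distr std_normal_distribution borel (\<lambda>z. m + \<sigma> * z) = density lborel (normal_density m \<sigma>)"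
proof -
  interpret real_distribution std_normal_distribution by (rule real_dist_normal_dist)
  have id: "distr std_normal_distribution lborel (\<lambda>x. x) = std_normal_distribution"
    by (rule distr_id2) simp
  have "distributed std_normal_distribution lborel (\<lambda>x. x) std_normal_density"
    using id by (auto simp: distributed_def normal_density_nonneg)
  from normal_density_affine[OF this, of \<sigma> m] assms
  have "distributed std_normal_distribution lborel (\<lambda>x. m + \<sigma> * x) (normal_density m \<sigma>)" by simp
  then have "distr std_normal_distribution lborel (\<lambda>x. m + \<sigma> * x) = density lborel (normal_density m \<sigma>)"
    by (simp add: distributed_def)
  moreover have "distr std_normal_distribution lborel (\<lambda>x. m + \<sigma> * x) = distr std_normal_distribution borel (\<lambda>x. m + \<sigma> * x)"
    by (rule distr_cong) auto
  ultimately show ?thesis by simp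
qed

text \<open>For variance 0 the affine image of a standard normal is a point mass, so both branches
  of \<open>gaussian_law\<close> become one formula and degenerate directions need no separate
  treatment later.\<close>

lemma gaussian_law_distr:
  assumes "gaussian_law I P mu S"
  shows "distr P borel (lin_form I a) =
    distr std_normal_distribution borel (\<lambda>z. lin_form I a mu + sqrt (quad_form I S a) * z)"
    and "quad_form I S a \<ge> 0"
proof -
  interpret prob_space std_normal_distribution
    using real_dist_normal_dist by (simp add: real_distribution_def)
  show "quad_form I S a \<ge> 0"
    using assms by (simp add: gaussian_law_def Let_def)
  then show "distr P borel (lin_form I a) =
    distr std_normal_distribution borel (\<lambda>z. lin_form I a mu + sqrt (quad_form I S a) * z)"
    using assms distr_std_normal_affine[of "sqrt (quad_form I S a)" "lin_form I a mu"]
    by (auto simp: gaussian_law_def Let_def less_le)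
qed

lemma gaussian_law_integral:
  fixes f :: "real \<Rightarrow> real"
  assumes P: "gaussian_law I P mu S" and [measurable]: "f \<in> borel_measurable borel"
  shows "(\<integral>x. f (lin_form I a x) \<partial>P) =
      (\<integral>z. f (lin_form I a mu + sqrt (quad_form I S a) * z) \<partial>std_normal_distribution)"
    and "integrable P (\<lambda>x. f (lin_form I a x)) \<longleftrightarrow>
      integrable std_normal_distribution (\<lambda>z. f (lin_form I a mu + sqrt (quad_form I S a) * z))"
proof -
  have [measurable_cong]: "sets P = sets (PiM I (\<lambda>_. borel))"
    using P by (simp add: gaussian_law_def)
  have [measurable]: "lin_form I a \<in> borel_measurable P" by measurable
  have 1: "(\<integral>x. f (lin_form I a x) \<partial>P) = (\<integral>y. f y \<partial>distr P borel (lin_form I a))"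
    by (subst integral_distr) auto
  have 2: "integrable P (\<lambda>x. f (lin_form I a x)) \<longleftrightarrow> integrable (distr P borel (lin_form I a)) f"
    by (subst integrable_distr_eq) auto
  show "(\<integral>x. f (lin_form I a x) \<partial>P) =
      (\<integral>z. f (lin_form I a mu + sqrt (quad_form I S a) * z) \<partial>std_normal_distribution)"
    unfolding 1 gaussian_law_distr[OF P] by (subst integral_distr) auto
  show "integrable P (\<lambda>x. f (lin_form I a x)) \<longleftrightarrow>
      integrable std_normal_distribution (\<lambda>z. f (lin_form I a mu + sqrt (quad_form I S a) * z))"
    unfolding 2 gaussian_law_distr[OF P] by (subst integrable_distr_eq) auto
qed

lemma integral_cos_std_normal:
  "(\<integral>z. cos (s * z + c) \<partial>std_normal_distribution) = exp (- s\<^sup>2 / 2) * cos c"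
proof -
  interpret real_distribution std_normal_distribution by (rule real_dist_normal_dist)
  have i: "integrable std_normal_distribution (\<lambda>z. iexp (s * z))"
    by (intro integrable_const_bound[of _ 1]) auto
  have "(\<integral>z. cos (s * z + c) \<partial>std_normal_distribution)
      = (\<integral>z. Re (iexp c * iexp (s * z)) \<partial>std_normal_distribution)"
    by (simp add: Re_exp Im_exp cos_add algebra_simps)
  also have "\<dots> = Re (CLINT z|std_normal_distribution. iexp c * iexp (s * z))"
    using i by (intro integral_Re) (auto simp del: of_real_mult)
  also have "\<dots> = Re (iexp c * char std_normal_distribution s)"
    by (subst integral_mult_right_zero) (simp only: char_def)
  also have "\<dots> = exp (- s\<^sup>2 / 2) * cos c"
    unfolding char_std_normal_distribution by (simp add: Re_exp)
  finally show ?thesis .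
qed

text \<open>The phase \<open>c\<close> encodes both the real and the imaginary part of the characteristic function.\<close>
definition gaussian_cos ::
  "'i set \<Rightarrow> ('i \<Rightarrow> real) measure \<Rightarrow> ('i \<Rightarrow> real) \<Rightarrow> ('i \<Rightarrow> 'i \<Rightarrow> real) \<Rightarrow> bool" where
  "gaussian_cos I P mu S \<longleftrightarrow> prob_space P \<and> sets P = sets (PiM I (\<lambda>_. borel)) \<and>
     (\<forall>a c. (\<integral>x. cos (lin_form I a x + c) \<partial>P) = exp (- quad_form I S a / 2) * cos (lin_form I a mu + c))"

lemma gaussian_cosI:
  assumes P: "gaussian_law I P mu S"
  shows "gaussian_cos I P mu S"
  unfolding gaussian_cos_def
proof (intro conjI allI)
  fix a c
  have "(\<integral>x. cos (lin_form I a x + c) \<partial>P)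
     = (\<integral>z. cos (sqrt (quad_form I S a) * z + (lin_form I a mu + c)) \<partial>std_normal_distribution)"
    by (subst gaussian_law_integral(1)[OF P]) (auto simp: ac_simps)
  then show "(\<integral>x. cos (lin_form I a x + c) \<partial>P) = exp (- quad_form I S a / 2) * cos (lin_form I a mu + c)"
    using gaussian_law_distr(2)[OF P] by (simp only: integral_cos_std_normal real_sqrt_pow2)
qed (use P in \<open>auto simp: gaussian_law_def\<close>)

text \<open>Lets one Gaussian law be built in several ways: constructions with equal mean and
  covariance are the same measure, not merely alike in their projections.\<close>

lemma gaussian_cos_unique:
  assumes "finite I" "gaussian_cos I P mu S" "gaussian_cos I Q mu S"
  shows "P = Q"
  using assms by (intro PiM_measure_eqI_cos[of I]) (auto simp: gaussian_cos_def prob_space_def)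

lemma gaussian_cos_return:
  "gaussian_cos I (return (PiM I (\<lambda>_. borel)) (restrict mu I)) mu (\<lambda>_ _. 0)"
proof -
  have "restrict mu I \<in> space (PiM I (\<lambda>_. borel))" by (simp add: space_PiM)
  then show ?thesis
    unfolding gaussian_cos_def by (auto intro!: prob_space_return simp: integral_return)
qed

section \<open>Sums of independent Gaussian vectors\<close>

lemma measurable_add_scaled:
  "(\<lambda>(x, y). \<lambda>i\<in>I. x i + t * (y i - nu i)) \<in>
     measurable (PiM I (\<lambda>_. borel) \<Otimes>\<^sub>M PiM I (\<lambda>_. borel)) (PiM I (\<lambda>_. borel :: real measure))"
  by measurable

text \<open>The product measure makes the two summands independent. Centering the increment at
  \<open>nu\<close> preserves the mean of \<open>P\<close> when \<open>nu\<close> is the mean of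
  \<open>Q\<close>, so only the covariance changes.\<close>

definition add_scaled ::
  "'i set \<Rightarrow> ('i \<Rightarrow> real) measure \<Rightarrow> real \<Rightarrow> ('i \<Rightarrow> real) measure \<Rightarrow> ('i \<Rightarrow> real) \<Rightarrow> ('i \<Rightarrow> real) measure" where
  "add_scaled I P t Q nu =
     distr (P \<Otimes>\<^sub>M Q) (PiM I (\<lambda>_. borel)) (\<lambda>(x, y). \<lambda>i\<in>I. x i + t * (y i - nu i))"

text \<open>Fubini in both orders: integrating over \<open>x\<close> first serves to compute
  characteristic functions, integrating over \<open>y\<close> first gives a replacement step
  conditional on \<open>x\<close>.\<close>

lemma integral_add_scaled:
  fixes f :: "('i \<Rightarrow> real) \<Rightarrow> real"
  assumes "prob_space P" and sP: "sets P = sets (PiM I (\<lambda>_. borel))"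
    and "prob_space Q" and sQ: "sets Q = sets (PiM I (\<lambda>_. borel))"
    and [measurable]: "f \<in> borel_measurable (PiM I (\<lambda>_. borel))" and bd: "\<And>x. \<bar>f x\<bar> \<le> B"
  shows "(\<integral>z. f z \<partial>add_scaled I P t Q nu) = (\<integral>x. \<integral>y. f (\<lambda>i\<in>I. x i + t * (y i - nu i)) \<partial>Q \<partial>P)" (is ?A)
    and "(\<integral>z. f z \<partial>add_scaled I P t Q nu) = (\<integral>y. \<integral>x. f (\<lambda>i\<in>I. x i + t * (y i - nu i)) \<partial>P \<partial>Q)" (is ?B)
    and "integrable P (\<lambda>x. \<integral>y. f (\<lambda>i\<in>I. x i + t * (y i - nu i)) \<partial>Q)" (is ?C)
proof -
  interpret P: prob_space P by fact
  interpret Q: prob_space Q by fact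
  interpret PQ: pair_prob_space P Q ..
  note [measurable_cong] = sP sQ and [measurable] = measurable_add_scaled
  have int: "integrable (P \<Otimes>\<^sub>M Q) (\<lambda>(x, y). f (\<lambda>i\<in>I. x i + t * (y i - nu i)))"
    using bd by (intro PQ.integrable_const_bound[of _ B]) auto
  have "(\<integral>z. f z \<partial>add_scaled I P t Q nu)
      = (\<integral>p. (case p of (x, y) \<Rightarrow> f (\<lambda>i\<in>I. x i + t * (y i - nu i))) \<partial>(P \<Otimes>\<^sub>M Q))"
    unfolding add_scaled_def by (subst integral_distr) (auto simp: split_beta')
  then show ?A ?B ?C
    using PQ.integral_fst'[OF int] PQ.integral_snd[OF int] PQ.integrable_fst'[OF int] by simp_all
qed

text \<open>The free phase in \<open>gaussian_cos\<close> absorbs \<open>y\<close> while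
  \<open>x\<close> is integrated out, and what remains is again a cosine of a linear form in
  \<open>y\<close>. The two exponential factors multiply, hence the covariances add.\<close>

lemma gaussian_cos_add_scaled:
  assumes P: "gaussian_cos I P mu S" and Q: "gaussian_cos I Q nu R"
  shows "gaussian_cos I (add_scaled I P t Q nu) mu (\<lambda>i j. S i j + t\<^sup>2 * R i j)"
proof -
  have pP: "prob_space P" and sP[measurable_cong]: "sets P = sets (PiM I (\<lambda>_. borel))"
    and pQ: "prob_space Q" and sQ[measurable_cong]: "sets Q = sets (PiM I (\<lambda>_. borel))"
    using P Q by (simp_all add: gaussian_cos_def)
  interpret P: prob_space P by fact
  interpret Q: prob_space Q by fact
  interpret PQ: pair_prob_space P Q ..
  note [measurable] = measurable_add_scaled
  have Pcos: "(\<integral>x. cos (lin_form I a x + c) \<partial>P) = exp (- quad_form I S a / 2) * cos (lin_form I a mu + c)" for a c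
    using P by (simp add: gaussian_cos_def)
  have "(\<integral>z. cos (lin_form I a z + c) \<partial>add_scaled I P t Q nu)
     = exp (- quad_form I (\<lambda>i j. S i j + t\<^sup>2 * R i j) a / 2) * cos (lin_form I a mu + c)" for a c
  proof -
    have "(\<integral>z. cos (lin_form I a z + c) \<partial>add_scaled I P t Q nu) =
       (\<integral>y. \<integral>x. cos (lin_form I a (\<lambda>i\<in>I. x i + t * (y i - nu i)) + c) \<partial>P \<partial>Q)"
      by (rule integral_add_scaled(2)[OF pP sP pQ sQ]) (measurable, rule abs_cos_le_one)
    also have "\<dots> = (\<integral>y. \<integral>x. cos (lin_form I a x + (lin_form I (\<lambda>i. t * a i) y + (c - lin_form I (\<lambda>i. t * a i) nu))) \<partial>P \<partial>Q)"
      by (simp add: algebra_simps sum.distrib sum_subtractf)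
    also have "\<dots> = (\<integral>y. exp (- quad_form I S a / 2) *
         cos (lin_form I (\<lambda>i. t * a i) y + (lin_form I a mu + c - lin_form I (\<lambda>i. t * a i) nu)) \<partial>Q)"
      by (simp only: Pcos) (simp only: add_diff_eq add.left_commute)
    also have "\<dots> = exp (- quad_form I S a / 2) * (exp (- quad_form I R (\<lambda>i. t * a i) / 2) * cos (lin_form I a mu + c))"
      using Q by (simp add: gaussian_cos_def)
    also have "\<dots> = exp (- quad_form I S a / 2 - quad_form I R (\<lambda>i. t * a i) / 2) * cos (lin_form I a mu + c)"
      by (simp add: exp_add[symmetric])
    also have "- quad_form I S a / 2 - quad_form I R (\<lambda>i. t * a i) / 2
        = - quad_form I (\<lambda>i j. S i j + t\<^sup>2 * R i j) a / 2"
    proof -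
      have "quad_form I (\<lambda>i j. S i j + t\<^sup>2 * R i j) a = quad_form I S a + quad_form I R (\<lambda>i. t * a i)"
        unfolding sum.distrib[symmetric]
        by (intro sum.cong refl) (simp add: algebra_simps power2_eq_square)
      then show ?thesis by simp
    qed
    finally show ?thesis .
  qed
  moreover have "prob_space (add_scaled I P t Q nu)"
    unfolding add_scaled_def by (rule PQ.prob_space_distr) measurable
  ultimately show ?thesis
    by (simp add: gaussian_cos_def add_scaled_def)
qed

section \<open>Moments of Gaussian vectors\<close>

lemma gaussian_law_moments:
  assumes P: "gaussian_law I P mu S"
  shows "integrable P (\<lambda>x. lin_form I a x - lin_form I a mu)"
    and "(\<integral>x. lin_form I a x - lin_form I a mu \<partial>P) = 0"
    and "integrable P (\<lambda>x. (lin_form I a x - lin_form I a mu)\<^sup>2)"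
    and "(\<integral>x. (lin_form I a x - lin_form I a mu)\<^sup>2 \<partial>P) = quad_form I S a"
    and "integrable P (\<lambda>x. \<bar>lin_form I a x - lin_form I a mu\<bar> ^ 3)"
proof -
  let ?m = "lin_form I a mu"
  have [simp]: "integrable std_normal_distribution (\<lambda>x. \<bar>x\<bar> ^ k)" for k
    using integrable_std_normal_distribution_moment[of k] by (simp flip: power_abs)
  note m1 = gaussian_law_integral[OF P, of "\<lambda>y. y - ?m" a]
   and m2 = gaussian_law_integral[OF P, of "\<lambda>y. (y - ?m)\<^sup>2" a]
   and m3 = gaussian_law_integral[OF P, of "\<lambda>y. \<bar>y - ?m\<bar> ^ 3" a]
  show "integrable P (\<lambda>x. lin_form I a x - ?m)"
    using m1(2) integrable_std_normal_distribution_moment[of 1] by simp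
  show "(\<integral>x. lin_form I a x - ?m \<partial>P) = 0"
    using m1(1) integral_std_normal_distribution_moment_odd[of 1] by simp
  show "integrable P (\<lambda>x. (lin_form I a x - ?m)\<^sup>2)"
    using m2(2) integrable_std_normal_distribution_moment[of 2] by (simp add: power_mult_distrib)
  show "(\<integral>x. (lin_form I a x - ?m)\<^sup>2 \<partial>P) = quad_form I S a"
    using m2(1) std_normal_distribution_even_moments(1)[of 1] gaussian_law_distr(2)[OF P, of a]
    by (simp add: power_mult_distrib)
  show "integrable P (\<lambda>x. \<bar>lin_form I a x - ?m\<bar> ^ 3)"
    using m3(2) by (simp add: power_mult_distrib abs_mult)
qed

text \<open>Coordinates are projections along the unit vectors \<open>e u\<close>. The mixed moment
  follows by polarization from the projection along \<open>e u + e v\<close>, with the symmetry of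
  \<open>S\<close> merging the two cross terms.\<close>

lemma gaussian_law_coordinate_moments:
  assumes P: "gaussian_law I P mu S" and I: "finite I" "u \<in> I"
  shows "integrable P (\<lambda>x. x u - mu u)"
    and "(\<integral>x. x u - mu u \<partial>P) = 0"
    and "integrable P (\<lambda>x. \<bar>x u - mu u\<bar> ^ 3)"
    and "v \<in> I \<Longrightarrow> integrable P (\<lambda>x. (x u - mu u) * (x v - mu v))"
    and "v \<in> I \<Longrightarrow> (\<integral>x. (x u - mu u) * (x v - mu v) \<partial>P) = S u v"
proof -
  define e where "e w = (\<lambda>i::'a. of_bool (i = w) :: real)" for w
  have e: "lin_form I (e w) x = x w" if "w \<in> I" for w x
    using that I(1) by (simp add: e_def of_bool_def if_distrib[of "\<lambda>z. z * _"] sum.delta cong: if_cong)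
  have ee: "lin_form I (\<lambda>i. e w i + e w' i) x = x w + x w'" if "w \<in> I" "w' \<in> I" for w w' x
    using that by (simp add: distrib_right sum.distrib e)
  have q: "quad_form I S a = lin_form I a (\<lambda>i. lin_form I a (S i))" for a
    by (simp add: sum_distrib_left mult.assoc)
  have sym: "S i j = S j i" if "i \<in> I" "j \<in> I" for i j
    using P that by (simp add: gaussian_law_def)
  show "integrable P (\<lambda>x. x u - mu u)" "(\<integral>x. x u - mu u \<partial>P) = 0" "integrable P (\<lambda>x. \<bar>x u - mu u\<bar> ^ 3)"
    using gaussian_law_moments(1,2,5)[OF P, of "e u"] I(2) by (simp_all add: e)
  have sq: "integrable P (\<lambda>x. (x w - mu w)\<^sup>2)" "(\<integral>x. (x w - mu w)\<^sup>2 \<partial>P) = S w w" if "w \<in> I" for w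
    using gaussian_law_moments(3,4)[OF P, of "e w"] that unfolding q by (simp_all add: e)
  assume v: "v \<in> I"
  have sq2: "integrable P (\<lambda>x. (x u + x v - (mu u + mu v))\<^sup>2)"
    "(\<integral>x. (x u + x v - (mu u + mu v))\<^sup>2 \<partial>P) = S u u + 2 * S u v + S v v"
    using gaussian_law_moments(3,4)[OF P, of "\<lambda>i. e u i + e v i"] v I(2) sym[of u v]
    unfolding q by (simp_all add: ee)
  have eq: "(\<lambda>x. (x u - mu u) * (x v - mu v))
     = (\<lambda>x. ((x u + x v - (mu u + mu v))\<^sup>2 - (x u - mu u)\<^sup>2 - (x v - mu v)\<^sup>2) / 2)"
    by (auto simp: power2_eq_square field_simps)
  show "integrable P (\<lambda>x. (x u - mu u) * (x v - mu v))"
    unfolding eq using sq2 sq[OF v] sq[OF I(2)] by auto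
  show "(\<integral>x. (x u - mu u) * (x v - mu v) \<partial>P) = S u v"
    unfolding eq using sq2 sq[OF v] sq[OF I(2)] by simp
qed

section \<open>Lindeberg comparison of Gaussian laws\<close>

lemma (in prob_space) abs_integral_le_const:
  fixes f :: "'a \<Rightarrow> real"
  assumes "integrable M f" "\<And>x. \<bar>f x\<bar> \<le> b"
  shows "\<bar>\<integral>x. f x \<partial>M\<bar> \<le> b"
proof -
  have "(\<integral>x. f x \<partial>M) \<le> b" "- b \<le> (\<integral>x. f x \<partial>M)"
    using assms by (auto intro!: integral_le_const integral_ge_const simp: abs_le_iff minus_le_iff)
  then show ?thesis by simp
qed

text \<open>The linear term has expectation zero because the increment is centered, and the
  quadratic term sees the law only through \<open>S\<close>. Everything else about \<open>P\<close>
  is pushed into the order \<open>t ^ 3\<close>.\<close>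

lemma gaussian_law_Taylor:
  fixes f :: "('i \<Rightarrow> real) \<Rightarrow> real"
  assumes I: "finite I" and P: "gaussian_law I P mu S"
    and [measurable]: "f \<in> borel_measurable (PiM I (\<lambda>_. borel))" and bd: "\<And>x. \<bar>f x\<bar> \<le> B"
    and t: "t \<ge> 0"
    and Taylor: "\<And>h. \<bar>f (\<lambda>i\<in>I. x i + h i) - (k + lin_form I l h + quad_form I c h / 2)\<bar> \<le> L * (\<Sum>i\<in>I. \<bar>h i\<bar> ^ 3)"
  shows "\<bar>(\<integral>y. f (\<lambda>i\<in>I. x i + t * (y i - mu i)) \<partial>P) - (k + t\<^sup>2 * (\<Sum>u\<in>I. \<Sum>v\<in>I. c u v * S u v) / 2)\<bar>
     \<le> t ^ 3 * (L * (\<Sum>i\<in>I. \<integral>y. \<bar>y i - mu i\<bar> ^ 3 \<partial>P))"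
proof -
  interpret prob_space P using P by (simp add: gaussian_law_def)
  have [measurable_cong]: "sets P = sets (PiM I (\<lambda>_. borel))"
    using P by (simp add: gaussian_law_def)
  note mom = gaussian_law_coordinate_moments[OF P I]
  let ?h = "\<lambda>y i. t * (y i - mu i)"
  let ?lin = "\<lambda>y. t * lin_form I l (\<lambda>i. y i - mu i)"
    and ?quad = "\<lambda>y. t\<^sup>2 * (\<Sum>u\<in>I. \<Sum>v\<in>I. c u v * ((y u - mu u) * (y v - mu v))) / 2"
  have int_f: "integrable P (\<lambda>y. f (\<lambda>i\<in>I. x i + ?h y i))"
    using bd by (intro integrable_const_bound[of _ B]) auto
  have int_lin: "integrable P ?lin" "(\<integral>y. ?lin y \<partial>P) = 0"
    using mom(1,2) by auto
  have int_quad: "integrable P ?quad" "(\<integral>y. ?quad y \<partial>P) = t\<^sup>2 * (\<Sum>u\<in>I. \<Sum>v\<in>I. c u v * S u v) / 2"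
    using mom(4,5) by (auto simp: Bochner_Integration.integral_sum)
  let ?rem = "\<lambda>y. f (\<lambda>i\<in>I. x i + ?h y i) - (k + ?lin y + ?quad y)"
  have int_rem: "integrable P ?rem"
    using int_f int_lin int_quad by auto
  have eq: "(\<integral>y. f (\<lambda>i\<in>I. x i + ?h y i) \<partial>P) - (k + t\<^sup>2 * (\<Sum>u\<in>I. \<Sum>v\<in>I. c u v * S u v) / 2) = (\<integral>y. ?rem y \<partial>P)"
    using int_f int_lin int_quad by (cases "t = 0") (simp_all add: prob_space)
  have "\<bar>\<integral>y. ?rem y \<partial>P\<bar> \<le> (\<integral>y. \<bar>?rem y\<bar> \<partial>P)"
    by (rule integral_abs_bound)
  also have "\<dots> \<le> (\<integral>y. t ^ 3 * (L * (\<Sum>i\<in>I. \<bar>y i - mu i\<bar> ^ 3)) \<partial>P)"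
  proof (rule integral_mono)
    fix y
    have "lin_form I l (?h y) = ?lin y" "quad_form I c (?h y) / 2 = ?quad y"
      by (simp_all add: sum_distrib_left power2_eq_square algebra_simps)
    moreover have "\<bar>?h y i\<bar> ^ 3 = t ^ 3 * \<bar>y i - mu i\<bar> ^ 3" for i
      using t by (simp add: abs_mult power_mult_distrib)
    then have "L * (\<Sum>i\<in>I. \<bar>?h y i\<bar> ^ 3) = t ^ 3 * (L * (\<Sum>i\<in>I. \<bar>y i - mu i\<bar> ^ 3))"
      by (simp only: sum_distrib_left[symmetric] mult.left_commute)
    ultimately show "\<bar>?rem y\<bar> \<le> t ^ 3 * (L * (\<Sum>i\<in>I. \<bar>y i - mu i\<bar> ^ 3))"
      using Taylor[of "?h y"] by (simp only:)
  qed (use int_rem mom(3) in auto)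
  also have "\<dots> = t ^ 3 * (L * (\<Sum>i\<in>I. \<integral>y. \<bar>y i - mu i\<bar> ^ 3 \<partial>P))"
    using mom(3) by (simp add: Bochner_Integration.integral_sum)
  finally show ?thesis unfolding eq .
qed

text \<open>Lindeberg's replacement argument: in the law of \<open>\<mu> + \<surd>s (X - \<mu>) + \<surd>(1 - s) (Y - \<mu>)\<close> an
  amount \<open>1/n\<close> of variance is moved from \<open>Y\<close> to \<open>X\<close> at a time. A second-order Taylor expansion
  shows that each of the \<open>n\<close> steps costs at most \<open>K D / (2 n) + O (n powr (-3/2))\<close>.\<close>

theorem gaussian_comparison:
  fixes f :: "('i \<Rightarrow> real) \<Rightarrow> real"
  assumes I: "finite I" and P: "gaussian_law I P mu S" and Q: "gaussian_law I Q mu R"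
    and f[measurable]: "f \<in> borel_measurable (PiM I (\<lambda>_. borel))" and bd: "\<And>x. \<bar>f x\<bar> \<le> B"
    and Taylor: "\<And>x. \<exists>k l c. (\<Sum>u\<in>I. \<Sum>v\<in>I. \<bar>c u v\<bar>) \<le> K \<and>
      (\<forall>h. \<bar>f (\<lambda>i\<in>I. x i + h i) - (k + lin_form I l h + quad_form I c h / 2)\<bar> \<le> L * (\<Sum>i\<in>I. \<bar>h i\<bar> ^ 3))"
    and D: "\<And>u v. u \<in> I \<Longrightarrow> v \<in> I \<Longrightarrow> \<bar>S u v - R u v\<bar> \<le> D" "0 \<le> D"
  shows "\<bar>(\<integral>x. f x \<partial>P) - (\<integral>x. f x \<partial>Q)\<bar> \<le> K * D / 2"
proof -
  note gP = gaussian_cosI[OF P] and gQ = gaussian_cosI[OF Q]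
  have pP: "prob_space P" and sP: "sets P = sets (PiM I (\<lambda>_. borel))"
    and pQ: "prob_space Q" and sQ: "sets Q = sets (PiM I (\<lambda>_. borel))"
    using P Q by (simp_all add: gaussian_law_def)
  define C where "C = L * (\<Sum>i\<in>I. \<integral>y. \<bar>y i - mu i\<bar> ^ 3 \<partial>P) + L * (\<Sum>i\<in>I. \<integral>y. \<bar>y i - mu i\<bar> ^ 3 \<partial>Q)"
  \<comment> \<open>The same expansion at \<open>x\<close> serves both laws, so \<open>k\<close>
    cancels and the second-order terms differ only through \<open>S - R\<close>.\<close>
  have step: "\<bar>(\<integral>y. f (\<lambda>i\<in>I. x i + t * (y i - mu i)) \<partial>P) - (\<integral>y. f (\<lambda>i\<in>I. x i + t * (y i - mu i)) \<partial>Q)\<bar>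
     \<le> t\<^sup>2 * (K * D / 2) + t ^ 3 * C" if t: "t \<ge> 0" for t x
  proof -
    obtain k l c where K: "(\<Sum>u\<in>I. \<Sum>v\<in>I. \<bar>c u v\<bar>) \<le> K"
      and T: "\<And>h. \<bar>f (\<lambda>i\<in>I. x i + h i) - (k + lin_form I l h + quad_form I c h / 2)\<bar> \<le> L * (\<Sum>i\<in>I. \<bar>h i\<bar> ^ 3)"
      using Taylor[of x] by blast
    have "\<bar>(\<Sum>u\<in>I. \<Sum>v\<in>I. c u v * S u v) - (\<Sum>u\<in>I. \<Sum>v\<in>I. c u v * R u v)\<bar>
        = \<bar>\<Sum>u\<in>I. \<Sum>v\<in>I. c u v * (S u v - R u v)\<bar>"
      by (simp add: right_diff_distrib sum_subtractf)
    also have "\<dots> \<le> (\<Sum>u\<in>I. \<Sum>v\<in>I. \<bar>c u v\<bar> * D)"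
      by (intro order_trans[OF sum_abs] sum_mono) (auto simp: abs_mult intro!: mult_left_mono D)
    also have "\<dots> \<le> K * D"
      using mult_right_mono[OF K D(2)] by (simp add: sum_distrib_right)
    finally have *: "\<bar>(\<Sum>u\<in>I. \<Sum>v\<in>I. c u v * S u v) - (\<Sum>u\<in>I. \<Sum>v\<in>I. c u v * R u v)\<bar> \<le> K * D" .
    have "\<bar>t\<^sup>2 * (\<Sum>u\<in>I. \<Sum>v\<in>I. c u v * S u v) / 2 - t\<^sup>2 * (\<Sum>u\<in>I. \<Sum>v\<in>I. c u v * R u v) / 2\<bar>
        = t\<^sup>2 * \<bar>(\<Sum>u\<in>I. \<Sum>v\<in>I. c u v * S u v) - (\<Sum>u\<in>I. \<Sum>v\<in>I. c u v * R u v)\<bar> / 2"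
      by (simp add: abs_mult flip: right_diff_distrib diff_divide_distrib)
    also have "\<dots> \<le> t\<^sup>2 * (K * D / 2)"
      using mult_left_mono[OF *, of "t\<^sup>2"] by simp
    finally have "\<bar>t\<^sup>2 * (\<Sum>u\<in>I. \<Sum>v\<in>I. c u v * S u v) / 2 - t\<^sup>2 * (\<Sum>u\<in>I. \<Sum>v\<in>I. c u v * R u v) / 2\<bar>
        \<le> t\<^sup>2 * (K * D / 2)" .
    with gaussian_law_Taylor[OF I P f bd t T] gaussian_law_Taylor[OF I Q f bd t T]
    show ?thesis unfolding C_def distrib_left by linarith
  qed
  \<comment> \<open>The law of \<open>mu + sqrt s (X - mu) + sqrt r (Y - mu)\<close> for independent
    X and Y, grown from the point mass at \<open>mu\<close>; uniqueness identifies its end points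
    with \<open>P\<close> and \<open>Q\<close>.\<close>
  define W where "W s r = add_scaled I (add_scaled I (return (PiM I (\<lambda>_. borel)) (restrict mu I)) (sqrt s) P mu) (sqrt r) Q mu"
    for s r
  have W: "gaussian_cos I (W s r) mu (\<lambda>i j. s * S i j + r * R i j)" if "s \<ge> 0" "r \<ge> 0" for s r
    using gaussian_cos_add_scaled[OF gaussian_cos_add_scaled[OF gaussian_cos_return gP] gQ, of mu "sqrt s" "sqrt r"] that
    by (simp add: W_def)
  have WP: "W 1 0 = P"
    using W[of 1 0] by (intro gaussian_cos_unique[OF I _ gP]) simp
  have WQ: "W 0 1 = Q"
    using W[of 0 1] by (intro gaussian_cos_unique[OF I _ gQ]) simp
  \<comment> \<open>Both laws are the common base \<open>W s r\<close> plus one small independent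
    increment, drawn from \<open>P\<close> or from \<open>Q\<close>; uniqueness justifies this
    regrouping, and \<open>step\<close> is then integrated over the base.\<close>
  have move: "\<bar>(\<integral>x. f x \<partial>W (s + \<epsilon>) r) - (\<integral>x. f x \<partial>W s (r + \<epsilon>))\<bar> \<le> \<epsilon> * (K * D / 2) + sqrt \<epsilon> ^ 3 * C"
    if s: "s \<ge> 0" "r \<ge> 0" "\<epsilon> \<ge> 0" for s r \<epsilon>
  proof -
    note gW = W[OF s(1,2)]
    have pW: "prob_space (W s r)" and sW: "sets (W s r) = sets (PiM I (\<lambda>_. borel))"
      using gW by (simp_all add: gaussian_cos_def)
    interpret prob_space "W s r" by fact
    have 1: "W (s + \<epsilon>) r = add_scaled I (W s r) (sqrt \<epsilon>) P mu"
    proof (rule gaussian_cos_unique[OF I W])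
      show "gaussian_cos I (add_scaled I (W s r) (sqrt \<epsilon>) P mu) mu (\<lambda>i j. (s + \<epsilon>) * S i j + r * R i j)"
        using gaussian_cos_add_scaled[OF gW gP, of "sqrt \<epsilon>"] s by (simp add: algebra_simps)
    qed (use s in auto)
    have 2: "W s (r + \<epsilon>) = add_scaled I (W s r) (sqrt \<epsilon>) Q mu"
    proof (rule gaussian_cos_unique[OF I W])
      show "gaussian_cos I (add_scaled I (W s r) (sqrt \<epsilon>) Q mu) mu (\<lambda>i j. s * S i j + (r + \<epsilon>) * R i j)"
        using gaussian_cos_add_scaled[OF gW gQ, of "sqrt \<epsilon>"] s by (simp add: algebra_simps)
    qed (use s in auto)
    note iP = integral_add_scaled(1,3)[OF pW sW pP sP f bd, of "sqrt \<epsilon>" mu]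
      and iQ = integral_add_scaled(1,3)[OF pW sW pQ sQ f bd, of "sqrt \<epsilon>" mu]
    have eq: "(\<integral>x. f x \<partial>W (s + \<epsilon>) r) - (\<integral>x. f x \<partial>W s (r + \<epsilon>)) =
      (\<integral>x. (\<integral>y. f (\<lambda>i\<in>I. x i + sqrt \<epsilon> * (y i - mu i)) \<partial>P)
          - (\<integral>y. f (\<lambda>i\<in>I. x i + sqrt \<epsilon> * (y i - mu i)) \<partial>Q) \<partial>W s r)"
      unfolding 1 2 iP(1) iQ(1) using iP(2) iQ(2) by simp
    have "\<bar>(\<integral>x. f x \<partial>W (s + \<epsilon>) r) - (\<integral>x. f x \<partial>W s (r + \<epsilon>))\<bar> \<le> (sqrt \<epsilon>)\<^sup>2 * (K * D / 2) + sqrt \<epsilon> ^ 3 * C"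
      unfolding eq using iP(2) iQ(2) step[of "sqrt \<epsilon>"] s(3)
      by (intro abs_integral_le_const Bochner_Integration.integrable_diff) (simp_all only: real_sqrt_ge_0_iff)
    then show ?thesis using s by simp
  qed
  have main: "\<bar>(\<integral>x. f x \<partial>P) - (\<integral>x. f x \<partial>Q)\<bar> \<le> K * D / 2 + C * sqrt (1 / real (Suc n))" for n
  proof -
    define N where "N = real (Suc n)"
    have N: "N > 0" by (simp add: N_def)
    define G where "G k = (\<integral>x. f x \<partial>W (real k / N) (1 - real k / N))" for k
    define q where "q = sqrt (1 / N)"
    have q: "N * q\<^sup>2 = 1" using N by (simp add: q_def)
    define E where "E = 1 / N * (K * D / 2) + q ^ 3 * C"
    have bound: "\<bar>G k - G 0\<bar> \<le> real k * E" if "k \<le> Suc n" for k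
      using that
    proof (induction k)
      case (Suc k)
      have e: "real k / N + 1 / N = real (Suc k) / N" "1 - real (Suc k) / N + 1 / N = 1 - real k / N"
        by (simp_all add: add_divide_distrib)
      have "real (Suc k) / N \<le> 1" using Suc.prems by (simp add: N_def)
      \<comment> \<open>The common base omits the piece of variance \<open>1 / N\<close> being
        exchanged; its second parameter is nonnegative because \<open>Suc k\<close> is at most
        \<open>N\<close>.\<close>
      with move[of "real k / N" "1 - real (Suc k) / N" "1 / N"] N
      have "\<bar>G (Suc k) - G k\<bar> \<le> E"
        unfolding e G_def E_def q_def by simp
      moreover have "real (Suc k) * E = real k * E + E" by (simp add: distrib_right)
      ultimately show ?case using Suc by linarith
    qed simp
    have "\<bar>G (Suc n) - G 0\<bar> \<le> N * E"
      using bound[of "Suc n"] unfolding N_def[symmetric] by simp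
    \<comment> \<open>Since \<open>N * q\<^sup>2 = 1\<close>, the accumulated cubic error is a
      single \<open>C * q\<close>, which tends to 0.\<close>
    also have "\<dots> = K * D / 2 + (N * q\<^sup>2) * (C * q)"
      using N by (simp add: E_def distrib_left power3_eq_cube power2_eq_square)
    also have "\<dots> = K * D / 2 + C * q" using q by simp
    finally have "\<bar>G (Suc n) - G 0\<bar> \<le> K * D / 2 + C * q" .
    moreover have "G (Suc n) = (\<integral>x. f x \<partial>P)" "G 0 = (\<integral>x. f x \<partial>Q)"
      unfolding G_def N_def[symmetric] using N by (simp_all add: WP WQ)
    ultimately show ?thesis unfolding q_def N_def by simp
  qed
  have "(\<lambda>n. K * D / 2 + C * sqrt (1 / real (Suc n))) \<longlonglongrightarrow> K * D / 2 + C * sqrt 0"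
    by (intro tendsto_intros LIMSEQ_Suc[OF lim_1_over_n])
  from LIMSEQ_le_const[OF this] main have "\<bar>(\<integral>x. f x \<partial>P) - (\<integral>x. f x \<partial>Q)\<bar> \<le> K * D / 2 + C * sqrt 0"
    by blast
  then show ?thesis by simp
qed

section \<open>Smooth cutoff functions\<close>

lemma ex_antiderivative:
  fixes f :: "real \<Rightarrow> real"
  assumes "continuous_on UNIV f"
  obtains F where "\<And>x. (F has_real_derivative f x) (at x)"
proof -
  have "\<exists>F. \<forall>x :: real. - \<infinity> < ereal x \<longrightarrow> ereal x < \<infinity> \<longrightarrow> (F has_vector_derivative f x) (at x)"
    by (rule einterval_antiderivative) (use assms in \<open>auto simp: continuous_on_eq_continuous_at\<close>)
  then show ?thesis
    using that by (auto simp: has_real_derivative_iff_has_vector_derivative)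
qed

text \<open>The mean of \<open>f\<close> over [x - r, x + r], written with an antiderivative, gains
  one derivative. By the mean value theorem it is a value of \<open>f\<close> nearby, so bounds and
  regions of constancy carry over up to a shift by \<open>r\<close>.\<close>

lemma ex_sliding_average:
  fixes f :: "real \<Rightarrow> real"
  assumes "continuous_on UNIV f" "r > 0"
  obtains g where "\<And>x. (g has_real_derivative (f (x + r) - f (x - r)) / (2 * r)) (at x)"
    and "\<And>x. \<exists>y. \<bar>y - x\<bar> \<le> r \<and> g x = f y"
proof -
  obtain F where F: "\<And>x. (F has_real_derivative f x) (at x)"
    using ex_antiderivative assms(1) by blast
  define g where "g x = (F (x + r) - F (x - r)) / (2 * r)" for x
  have "(g has_real_derivative (f (x + r) - f (x - r)) / (2 * r)) (at x)" for x
    unfolding g_def using assms(2)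
    by (auto intro!: derivative_eq_intros DERIV_chain2[OF F] simp: field_simps)
  moreover have "\<exists>y. \<bar>y - x\<bar> \<le> r \<and> g x = f y" for x
  proof -
    obtain z where "x - r < z" "z < x + r" "F (x + r) - F (x - r) = (x + r - (x - r)) * f z"
      using MVT2[of "x - r" "x + r" F f] F assms(2) by auto
    then show ?thesis
      using assms(2) by (intro exI[of _ z]) (auto simp: g_def)
  qed
  ultimately show ?thesis using that by blast
qed

lemma has_real_derivative_imp_lipschitz:
  fixes f :: "real \<Rightarrow> real"
  assumes "\<And>x. (f has_real_derivative f' x) (at x)" "\<And>x. \<bar>f' x\<bar> \<le> B"
  shows "\<bar>f x - f y\<bar> \<le> B * \<bar>x - y\<bar>"
  using field_differentiable_bound[of UNIV f f' B x y] assms by auto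

text \<open>The cutoff is obtained from a piecewise linear function of the distance to \<open>A\<close> by averaging twice.\<close>
lemma ex_smooth_cutoff:
  fixes A :: "real set" and \<delta> :: real
  assumes A: "A \<noteq> {}" and \<delta>: "\<delta> > 0"
  obtains g g' g'' where
    "\<And>x. (g has_real_derivative g' x) (at x)" "\<And>x. (g' has_real_derivative g'' x) (at x)"
    "\<And>x. 0 \<le> g x" "\<And>x. g x \<le> 1" "\<And>x. infdist x A \<le> \<delta> \<Longrightarrow> g x = 1"
    "\<And>x. infdist x A \<ge> 4 * \<delta> \<Longrightarrow> g x = 0"
    "\<And>x. \<bar>g' x\<bar> \<le> 1 / \<delta>" "\<And>x. \<bar>g'' x\<bar> \<le> 2 / \<delta>\<^sup>2"
    "\<And>x y. \<bar>g'' x - g'' y\<bar> \<le> 4 / \<delta> ^ 3 * \<bar>x - y\<bar>"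
proof -
  \<comment> \<open>\<open>g0\<close> is 1 up to distance 2 \<delta> and 0 from 3 \<delta> on. Two
    averages of radius \<delta>/2 shift the argument by at most \<delta> in total, which yields the
    thresholds \<delta> and 4 \<delta>.\<close>
  define g0 where "g0 x = max 0 (min 1 (3 - infdist x A / \<delta>))" for x
  define r where "r = \<delta> / 2"
  have r: "r > 0" "2 * r = \<delta>" using \<delta> by (simp_all add: r_def)
  have id: "\<bar>infdist x A - infdist y A\<bar> \<le> \<bar>x - y\<bar>" for x y
    using infdist_triangle_abs[of x A y] by (simp add: dist_real_def)
  have shift: "x + r - (y + r) = x - y" "x - r - (y - r) = x - y" for x y :: real
    by simp_all
  have g0: "0 \<le> g0 x" "g0 x \<le> 1" for x by (simp_all add: g0_def)
  have lip0: "\<bar>g0 x - g0 y\<bar> \<le> \<bar>x - y\<bar> / \<delta>" for x y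
  proof -
    have "\<bar>infdist x A / \<delta> - infdist y A / \<delta>\<bar> \<le> \<bar>x - y\<bar> / \<delta>"
      using divide_right_mono[OF id[of x y], of \<delta>] \<delta> by (simp add: abs_divide flip: diff_divide_distrib)
    then show ?thesis unfolding g0_def by linarith
  qed
  have "continuous_on UNIV g0"
    unfolding g0_def using \<delta> by (auto intro!: continuous_intros)
  then obtain g1 where g1: "\<And>x. (g1 has_real_derivative (g0 (x + r) - g0 (x - r)) / (2 * r)) (at x)"
    and m1: "\<And>x. \<exists>y. \<bar>y - x\<bar> \<le> r \<and> g1 x = g0 y"
    using ex_sliding_average r(1) by blast
  define d1 where "d1 x = (g0 (x + r) - g0 (x - r)) / \<delta>" for x
  have g1: "(g1 has_real_derivative d1 x) (at x)" for x using g1 by (simp add: r(2) d1_def)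
  have d1: "\<bar>d1 x\<bar> \<le> 1 / \<delta>" for x
    unfolding d1_def abs_divide using \<delta> g0[of "x + r"] g0[of "x - r"]
    by (intro frac_le) auto
  \<comment> \<open>A derivative of an average is a difference of two shifted copies divided by
    \<delta>, so each averaging multiplies the Lipschitz constant by 2 / \<delta>: from 1 / \<delta>
    for \<open>g0\<close> to 2 / \<delta>^2 here and 4 / \<delta>^3 for \<open>dd2\<close>.\<close>
  have lip1: "\<bar>d1 x - d1 y\<bar> \<le> 2 / \<delta>\<^sup>2 * \<bar>x - y\<bar>" for x y
  proof -
    have "\<bar>d1 x - d1 y\<bar> = \<bar>(g0 (x + r) - g0 (y + r)) - (g0 (x - r) - g0 (y - r))\<bar> / \<delta>"
      unfolding d1_def using \<delta> by (simp add: diff_divide_distrib[symmetric] algebra_simps)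
    also have "\<dots> \<le> (\<bar>x - y\<bar> / \<delta> + \<bar>x - y\<bar> / \<delta>) / \<delta>"
      using lip0[of "x + r" "y + r"] lip0[of "x - r" "y - r"] \<delta>
      unfolding shift
      by (intro divide_right_mono) linarith+
    finally show ?thesis by (simp add: power2_eq_square field_simps)
  qed
  have "continuous_on UNIV g1"
    using g1 by (intro continuous_at_imp_continuous_on ballI DERIV_isCont) auto
  then obtain g2 where g2: "\<And>x. (g2 has_real_derivative (g1 (x + r) - g1 (x - r)) / (2 * r)) (at x)"
    and m2: "\<And>x. \<exists>y. \<bar>y - x\<bar> \<le> r \<and> g2 x = g1 y"
    using ex_sliding_average r(1) by blast
  define d2 where "d2 x = (g1 (x + r) - g1 (x - r)) / \<delta>" for x
  define dd2 where "dd2 x = (d1 (x + r) - d1 (x - r)) / \<delta>" for x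
  have m: "\<exists>y. \<bar>y - x\<bar> \<le> \<delta> \<and> g2 x = g0 y" for x
  proof -
    obtain y where y: "\<bar>y - x\<bar> \<le> r" "g2 x = g1 y" using m2 by blast
    moreover obtain z where "\<bar>z - y\<bar> \<le> r" "g1 y = g0 z" using m1 by blast
    ultimately show ?thesis using r(2) by (intro exI[of _ z]) auto
  qed
  show ?thesis
  proof (rule that)
    show "(g2 has_real_derivative d2 x) (at x)" for x using g2 by (simp add: r(2) d2_def)
    show "(d2 has_real_derivative dd2 x) (at x)" for x
      unfolding d2_def dd2_def using \<delta>
      by (auto intro!: derivative_eq_intros DERIV_chain2[OF g1])
    show "0 \<le> g2 x" "g2 x \<le> 1" for x using m[of x] g0 by metis+
    show "g2 x = 1" if "infdist x A \<le> \<delta>" for x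
    proof -
      obtain y where y: "\<bar>y - x\<bar> \<le> \<delta>" "g2 x = g0 y" using m by blast
      have "infdist y A \<le> 2 * \<delta>" using id[of x y] y that by linarith
      then have "infdist y A / \<delta> \<le> 2" using \<delta> by (simp add: divide_le_eq)
      then show ?thesis using y by (simp add: g0_def)
    qed
    show "g2 x = 0" if "infdist x A \<ge> 4 * \<delta>" for x
    proof -
      obtain y where y: "\<bar>y - x\<bar> \<le> \<delta>" "g2 x = g0 y" using m by blast
      have "infdist y A \<ge> 3 * \<delta>" using id[of x y] y that by linarith
      then have "infdist y A / \<delta> \<ge> 3" using \<delta> by (simp add: le_divide_eq)
      then show ?thesis using y by (simp add: g0_def)
    qed
    have "0 \<le> g1 x \<and> g1 x \<le> 1" for x using m1[of x] g0 by metis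
    then show "\<bar>d2 x\<bar> \<le> 1 / \<delta>" for x
      unfolding d2_def abs_divide using \<delta>
      by (intro frac_le) (auto simp: abs_le_iff diff_le_eq intro: add_increasing add_increasing2)
    show "\<bar>dd2 x\<bar> \<le> 2 / \<delta>\<^sup>2" for x
    proof -
      have "\<bar>dd2 x\<bar> \<le> (1 / \<delta> + 1 / \<delta>) / \<delta>"
        unfolding dd2_def abs_divide using \<delta> d1[of "x + r"] d1[of "x - r"]
        by (intro frac_le order_trans[OF abs_triangle_ineq4] add_mono) auto
      then show ?thesis by (simp add: power2_eq_square)
    qed
    show "\<bar>dd2 x - dd2 y\<bar> \<le> 4 / \<delta> ^ 3 * \<bar>x - y\<bar>" for x y
    proof -
      have "\<bar>dd2 x - dd2 y\<bar> = \<bar>(d1 (x + r) - d1 (y + r)) - (d1 (x - r) - d1 (y - r))\<bar> / \<delta>"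
        unfolding dd2_def using \<delta> by (simp add: diff_divide_distrib[symmetric] algebra_simps)
      also have "\<dots> \<le> (2 / \<delta>\<^sup>2 * \<bar>x - y\<bar> + 2 / \<delta>\<^sup>2 * \<bar>x - y\<bar>) / \<delta>"
        using lip1[of "x + r" "y + r"] lip1[of "x - r" "y - r"] \<delta>
      unfolding shift
        by (intro divide_right_mono) linarith+
      finally show ?thesis by (simp add: power2_eq_square power3_eq_cube field_simps)
    qed
  qed
qed

section \<open>The smoothed min-max statistic\<close>

abbreviation norm_weight :: "'k set \<Rightarrow> ('k \<Rightarrow> real) \<Rightarrow> 'k \<Rightarrow> real" where
  "norm_weight K w k \<equiv> w k / sum w K"

text \<open>An expectation under the probability vector proportional to \<open>w\<close>; with
  exponential weights, a Gibbs average.\<close>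

definition wavg :: "'k set \<Rightarrow> ('k \<Rightarrow> real) \<Rightarrow> ('k \<Rightarrow> real) \<Rightarrow> real" where
  "wavg K w c = (\<Sum>k\<in>K. norm_weight K w k * c k)"

lemma wavg_linear:
  "wavg K w (\<lambda>k. c k + d k) = wavg K w c + wavg K w d"
  "wavg K w (\<lambda>k. c k - d k) = wavg K w c - wavg K w d"
  "wavg K w (\<lambda>k. t * c k) = t * wavg K w c"
  by (simp_all add: wavg_def distrib_left right_diff_distrib sum.distrib sum_subtractf sum_distrib_left mult.left_commute)

lemma sum_norm_weight:
  assumes "finite K" "K \<noteq> {}" "\<And>k. w k > 0"
  shows "sum (norm_weight K w) K = 1"
  using sum_pos[of K w] assms by (simp flip: sum_divide_distrib)

lemma abs_wavg_le:
  assumes K: "finite K" "K \<noteq> {}" "\<And>k. w k > 0" and c: "\<And>k. k \<in> K \<Longrightarrow> \<bar>c k\<bar> \<le> B"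
  shows "\<bar>wavg K w c\<bar> \<le> B"
proof -
  have "sum w K > 0" using K by (intro sum_pos) auto
  then have "\<bar>wavg K w c\<bar> \<le> (\<Sum>k\<in>K. norm_weight K w k * B)"
    unfolding wavg_def using K(3) c
    by (intro order_trans[OF sum_abs] sum_mono)
       (auto simp: abs_mult less_imp_le intro!: divide_right_mono mult_left_mono)
  also have "\<dots> = B"
    by (simp only: sum_distrib_right[symmetric] sum_norm_weight[OF K] mult_1)
  finally show ?thesis .
qed

text \<open>\<open>r\<close> is the logarithmic derivative of the weights, so the quotient rule
  produces the average of \<open>c'\<close> plus the weighted covariance of \<open>r\<close> and
  \<open>c\<close>.\<close>

lemma has_derivative_wavg:
  fixes w :: "real \<Rightarrow> 'k \<Rightarrow> real"
  assumes K: "finite K" "K \<noteq> {}" "\<And>k. w s k > 0"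
    and w: "\<And>k. k \<in> K \<Longrightarrow> ((\<lambda>s. w s k) has_real_derivative w s k * r k) (at s)"
    and c: "\<And>k. k \<in> K \<Longrightarrow> ((\<lambda>s. c s k) has_real_derivative c' k) (at s)"
  shows "((\<lambda>s. wavg K (w s) (c s)) has_real_derivative
    wavg K (w s) c' + (wavg K (w s) (\<lambda>k. r k * c s k) - wavg K (w s) r * wavg K (w s) (c s))) (at s)"
proof -
  let ?S = "\<Sum>k\<in>K. w s k"
  have S: "?S > 0" using K by (intro sum_pos) auto
  have avg: "wavg K v d = (\<Sum>k\<in>K. v k * d k) / sum v K" for v d
    by (simp add: wavg_def sum_divide_distrib)
  have "((\<lambda>s. (\<Sum>k\<in>K. w s k * c s k) / sum (w s) K) has_real_derivative
     ((\<Sum>k\<in>K. w s k * r k * c s k + c' k * w s k) * ?S - (\<Sum>k\<in>K. w s k * c s k) * (\<Sum>k\<in>K. w s k * r k)) / (?S * ?S)) (at s)"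
    using S by (intro DERIV_divide DERIV_sum DERIV_mult w c) auto
  also have "((\<Sum>k\<in>K. w s k * r k * c s k + c' k * w s k) * ?S - (\<Sum>k\<in>K. w s k * c s k) * (\<Sum>k\<in>K. w s k * r k)) / (?S * ?S)
     = wavg K (w s) c' + (wavg K (w s) (\<lambda>k. r k * c s k) - wavg K (w s) r * wavg K (w s) (c s))"
    using S unfolding avg by (simp add: sum.distrib field_simps)
  finally show ?thesis unfolding avg .
qed

lemma abs_mult_diff_le:
  fixes c c' d d' :: real
  assumes "\<bar>c - c'\<bar> \<le> L" "\<bar>d - d'\<bar> \<le> L'" "\<bar>c\<bar> \<le> B" "\<bar>d'\<bar> \<le> B'"
  shows "\<bar>c * d - c' * d'\<bar> \<le> B * L' + L * B'"
proof -
  have "\<bar>c * d - c' * d'\<bar> = \<bar>c * (d - d') + (c - c') * d'\<bar>" by (simp add: algebra_simps)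
  also have "\<dots> \<le> \<bar>c\<bar> * \<bar>d - d'\<bar> + \<bar>c - c'\<bar> * \<bar>d'\<bar>"
    using abs_triangle_ineq by (simp flip: abs_mult)
  also have "\<dots> \<le> B * L' + L * B'"
    using assms by (intro add_mono mult_mono) auto
  finally show ?thesis .
qed

lemma abs_power2_le: "\<bar>y\<bar> \<le> B \<Longrightarrow> \<bar>y\<^sup>2\<bar> \<le> B\<^sup>2" for y B :: real
  using power_mono[of "\<bar>y\<bar>" B 2] by simp

lemma abs_mult_le: "\<bar>c\<bar> \<le> B \<Longrightarrow> \<bar>d\<bar> \<le> D \<Longrightarrow> \<bar>c * d\<bar> \<le> B * D" for c d B D :: real
  by (auto simp: abs_mult intro!: mult_mono)

text \<open>The soft minimum of the row-wise soft maxima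
  \<open>ln (sum of exp (\<beta> x)) / \<beta>\<close>. With the same \<beta> at both levels, the
  inner logarithm cancels and leaves the reciprocal of each row sum.\<close>

definition smooth_minmax :: "nat \<Rightarrow> nat \<Rightarrow> real \<Rightarrow> (nat \<times> nat \<Rightarrow> real) \<Rightarrow> real" where
  "smooth_minmax N p \<beta> x = - ln (\<Sum>k<N. 1 / (\<Sum>j<p. exp (\<beta> * x (k, j)))) / \<beta>"

lemma minmax_stat_attained:
  assumes "N > 0" "p > 0"
  obtains k where "k < N" "minmax_stat N p x = Max ((\<lambda>j. x (k, j)) ` {..<p})"
    and "\<And>k'. k' < N \<Longrightarrow> minmax_stat N p x \<le> Max ((\<lambda>j. x (k', j)) ` {..<p})"
proof -
  have "minmax_stat N p x \<in> (\<lambda>k. Max ((\<lambda>j. x (k, j)) ` {..<p})) ` {..<N}"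
    unfolding minmax_stat_def using assms by (intro Min_in) auto
  then obtain k where "k < N" "minmax_stat N p x = Max ((\<lambda>j. x (k, j)) ` {..<p})" by auto
  moreover have "minmax_stat N p x \<le> Max ((\<lambda>j. x (k', j)) ` {..<p})" if "k' < N" for k'
    unfolding minmax_stat_def using that by (intro Min_le) auto
  ultimately show ?thesis using that by blast
qed

text \<open>From below, keep only the minimizing row, whose sum is at most
  \<open>p * exp (\<beta> * T)\<close>. From above, every row has an entry of at least
  \<open>T\<close>, so its sum is at least \<open>exp (\<beta> * T)\<close>. The errors are thus
  \<open>ln p / \<beta>\<close> on one side and \<open>ln N / \<beta>\<close> on the other.\<close>

lemma smooth_minmax_bounds:
  assumes N: "N > 0" and p: "p > 0" and \<beta>: "\<beta> > 0"
  shows "\<bar>smooth_minmax N p \<beta> x - minmax_stat N p x\<bar> \<le> ln (real (N * p)) / \<beta>"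
proof -
  define T where "T = minmax_stat N p x"
  obtain k where k: "k < N" "T = Max ((\<lambda>j. x (k, j)) ` {..<p})"
    and le: "\<And>k'. k' < N \<Longrightarrow> T \<le> Max ((\<lambda>j. x (k', j)) ` {..<p})"
    unfolding T_def using minmax_stat_attained[OF N p] by blast
  define E where "E k = (\<Sum>j<p. exp (\<beta> * x (k, j)))" for k
  define Z where "Z = (\<Sum>k<N. 1 / E k)"
  have E: "E k > 0" for k unfolding E_def using p by (intro sum_pos) auto
  have "E k \<le> (\<Sum>j<p. exp (\<beta> * T))"
    unfolding E_def using \<beta> by (intro sum_mono) (auto simp: k(2) intro!: Max_ge)
  then have "1 / (p * exp (\<beta> * T)) \<le> 1 / E k"
    using E[of k] by (intro divide_left_mono) auto
  also have "1 / E k \<le> Z"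
    unfolding Z_def using k(1) E by (intro member_le_sum) (auto simp: less_imp_le)
  finally have lower: "1 / (p * exp (\<beta> * T)) \<le> Z" .
  have "exp (\<beta> * T) \<le> E k'" if k': "k' < N" for k'
  proof -
    have "Max ((\<lambda>j. x (k', j)) ` {..<p}) \<in> (\<lambda>j. x (k', j)) ` {..<p}"
      using p by (intro Max_in) auto
    then obtain j where j: "j < p" "Max ((\<lambda>j. x (k', j)) ` {..<p}) = x (k', j)" by auto
    have "exp (\<beta> * T) \<le> exp (\<beta> * x (k', j))" using le[OF k'] j \<beta> by simp
    also have "\<dots> \<le> E k'" unfolding E_def using j by (intro member_le_sum) auto
    finally show ?thesis .
  qed
  then have "Z \<le> (\<Sum>k<N. 1 / exp (\<beta> * T))"
    unfolding Z_def by (intro sum_mono divide_left_mono) (auto intro: mult_pos_pos E)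
  then have upper: "Z \<le> N / exp (\<beta> * T)" by simp
  have Z: "Z > 0" unfolding Z_def using N E by (intro sum_pos) auto
  have "ln (1 / (p * exp (\<beta> * T))) \<le> ln Z"
    using lower p Z by (intro ln_mono) auto
  then have 1: "- ln Z \<le> \<beta> * T + ln p" using p by (simp add: ln_div ln_mult)
  have "ln Z \<le> ln (N / exp (\<beta> * T))" using upper N Z by (intro ln_mono) auto
  then have 2: "- ln Z \<ge> \<beta> * T - ln N" using N by (simp add: ln_div)
  have Np: "ln (real (N * p)) = ln N + ln p" "ln (real N) \<ge> 0" "ln (real p) \<ge> 0"
    using N p by (simp_all add: ln_mult)
  have "\<bar>- ln Z - \<beta> * T\<bar> \<le> ln (real (N * p))" using 1 2 Np by linarith
  then have "\<bar>(- ln Z - \<beta> * T) / \<beta>\<bar> \<le> ln (real (N * p)) / \<beta>"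
    using \<beta> by (simp add: abs_divide divide_right_mono)
  also have "(- ln Z - \<beta> * T) / \<beta> = smooth_minmax N p \<beta> x - T"
    using \<beta> by (simp add: smooth_minmax_def Z_def E_def diff_divide_distrib)
  finally show ?thesis by (simp add: T_def)
qed

section \<open>Derivatives of the smoothed statistic along a line\<close>

text \<open>Restricting to the line through \<open>x\<close> with direction \<open>h\<close> reduces
  the multivariate expansion to one-variable calculus; \<open>H\<close> bounds the direction in the
  sup norm.\<close>

locale minmax_line =
  fixes N p :: nat and \<beta> H :: real and x h :: "nat \<times> nat \<Rightarrow> real"
  assumes N: "N > 0" and p: "p > 0" and \<beta>: "\<beta> > 0"
    and H: "\<And>k j. k < N \<Longrightarrow> j < p \<Longrightarrow> \<bar>h (k, j)\<bar> \<le> H"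
begin

definition E where "E s k j = exp (\<beta> * (x (k, j) + s * h (k, j)))"
definition U where "U s k = 1 / (\<Sum>j<p. E s k j)"
abbreviation row where "row s k \<equiv> wavg {..<p} (E s k)"
abbreviation avg where "avg s \<equiv> wavg {..<N} (U s)"
definition a where "a s k = row s k (\<lambda>j. h (k, j))"
definition b where "b s k = row s k (\<lambda>j. (h (k, j))\<^sup>2)"
definition m where "m s = avg s (a s)"
text \<open>This is \<beta> times the average variance within rows, \<open>b - a\<^sup>2\<close>,
  minus \<beta> times the variance of the row means across rows: the soft maximum contributes
  convexly, the soft minimum concavely.\<close>

definition m' where "m' s = \<beta> * (avg s (b s) - 2 * avg s (\<lambda>k. (a s k)\<^sup>2) + (m s)\<^sup>2)"
definition F where "F s = smooth_minmax N p \<beta> (\<lambda>i. x i + s * h i)"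

lemma E_pos: "E s k j > 0" by (simp add: E_def)

lemma sum_E_pos: "(\<Sum>j<p. E s k j) > 0"
  using p by (intro sum_pos E_pos) auto

lemma U_pos: "U s k > 0" by (simp add: U_def sum_E_pos)

lemma H_nonneg: "H \<ge> 0"
  using H[of 0 0] N p by simp

lemma abs_row_le: "(\<And>j. j < p \<Longrightarrow> \<bar>c j\<bar> \<le> B) \<Longrightarrow> \<bar>row s k c\<bar> \<le> B"
  using p E_pos by (intro abs_wavg_le) auto

lemma abs_avg_le: "(\<And>k. k < N \<Longrightarrow> \<bar>c k\<bar> \<le> B) \<Longrightarrow> \<bar>avg s c\<bar> \<le> B"
  using N U_pos by (intro abs_wavg_le) auto

lemma abs_h_power_le: "k < N \<Longrightarrow> j < p \<Longrightarrow> \<bar>h (k, j) ^ n\<bar> \<le> H ^ n"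
  unfolding power_abs by (intro power_mono H) auto

lemma a_le: "k < N \<Longrightarrow> \<bar>a s k\<bar> \<le> H"
  unfolding a_def by (intro abs_row_le H)

lemma b_le: "k < N \<Longrightarrow> \<bar>b s k\<bar> \<le> H\<^sup>2"
  unfolding b_def by (intro abs_row_le abs_h_power_le)

lemma m_le: "\<bar>m s\<bar> \<le> H"
  unfolding m_def by (intro abs_avg_le a_le)

lemma DERIV_row:
  "((\<lambda>s. row s k c) has_real_derivative \<beta> * (row s k (\<lambda>j. h (k, j) * c j) - a s k * row s k c)) (at s)"
proof -
  have "((\<lambda>s. row s k c) has_real_derivative row s k (\<lambda>_. 0) +
     (row s k (\<lambda>j. \<beta> * h (k, j) * c j) - row s k (\<lambda>j. \<beta> * h (k, j)) * row s k c)) (at s)"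
    using p E_pos by (intro has_derivative_wavg) (auto simp: E_def intro!: derivative_eq_intros)
  also have "row s k (\<lambda>_. 0) + (row s k (\<lambda>j. \<beta> * h (k, j) * c j) - row s k (\<lambda>j. \<beta> * h (k, j)) * row s k c)
    = \<beta> * (row s k (\<lambda>j. h (k, j) * c j) - a s k * row s k c)"
    by (simp add: wavg_linear a_def mult.assoc right_diff_distrib) (simp add: wavg_def)
  finally show ?thesis .
qed

lemma DERIV_U: "((\<lambda>s. U s k) has_real_derivative U s k * (- \<beta> * a s k)) (at s)"
proof -
  have "((\<lambda>s. U s k) has_real_derivative - (\<Sum>j<p. E s k j * (\<beta> * h (k, j))) / (\<Sum>j<p. E s k j)\<^sup>2) (at s)"
    unfolding U_def using sum_E_pos[of s k]
    by (auto intro!: derivative_eq_intros simp: E_def power2_eq_square mult.commute[of \<beta>])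
  also have "- (\<Sum>j<p. E s k j * (\<beta> * h (k, j))) / (\<Sum>j<p. E s k j)\<^sup>2 = U s k * (- \<beta> * a s k)"
    by (simp add: U_def a_def wavg_def sum_distrib_left sum_divide_distrib power2_eq_square sum_negf ac_simps)
  finally show ?thesis .
qed

text \<open>The row weights \<open>U\<close> have logarithmic derivative
  \<open>- \<beta> * a\<close>, so the covariance term enters with a minus sign.\<close>

lemma DERIV_avg:
  assumes "\<And>k. k < N \<Longrightarrow> ((\<lambda>s. c s k) has_real_derivative c' k) (at s)"
  shows "((\<lambda>s. avg s (c s)) has_real_derivative
     avg s c' - \<beta> * (avg s (\<lambda>k. a s k * c s k) - m s * avg s (c s))) (at s)"
proof -
  have "((\<lambda>s. avg s (c s)) has_real_derivative avg s c' +
     (avg s (\<lambda>k. - \<beta> * a s k * c s k) - avg s (\<lambda>k. - \<beta> * a s k) * avg s (c s))) (at s)"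
    using N U_pos assms by (intro has_derivative_wavg DERIV_U) auto
  also have "avg s c' + (avg s (\<lambda>k. - \<beta> * a s k * c s k) - avg s (\<lambda>k. - \<beta> * a s k) * avg s (c s))
    = avg s c' - \<beta> * (avg s (\<lambda>k. a s k * c s k) - m s * avg s (c s))"
    using wavg_linear(3)[of "{..<N}" "U s" "- \<beta>"] by (simp add: m_def mult.assoc right_diff_distrib del: mult_minus_left)
  finally show ?thesis .
qed

lemma DERIV_a: "((\<lambda>s. a s k) has_real_derivative \<beta> * (b s k - (a s k)\<^sup>2)) (at s)"
  using DERIV_row[of k "\<lambda>j. h (k, j)" s] unfolding a_def b_def by (simp add: power2_eq_square)

lemma DERIV_b: "((\<lambda>s. b s k) has_real_derivative \<beta> * (row s k (\<lambda>j. h (k, j) ^ 3) - a s k * b s k)) (at s)"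
  using DERIV_row[of k "\<lambda>j. (h (k, j))\<^sup>2" s] unfolding b_def by (simp add: power2_eq_square power3_eq_cube mult.assoc)

lemma DERIV_m: "(m has_real_derivative m' s) (at s)"
proof -
  have "((\<lambda>s. avg s (a s)) has_real_derivative avg s (\<lambda>k. \<beta> * (b s k - (a s k)\<^sup>2)) -
      \<beta> * (avg s (\<lambda>k. a s k * a s k) - m s * avg s (a s))) (at s)"
    by (intro DERIV_avg DERIV_a)
  also have "avg s (\<lambda>k. \<beta> * (b s k - (a s k)\<^sup>2)) - \<beta> * (avg s (\<lambda>k. a s k * a s k) - m s * avg s (a s)) = m' s"
    by (simp add: wavg_linear m'_def m_def[symmetric] power2_eq_square algebra_simps)
  finally show ?thesis unfolding m_def[symmetric] .
qed

lemma DERIV_F: "(F has_real_derivative m s) (at s)"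
proof -
  have Z: "(\<Sum>k<N. U s k) > 0" using N by (intro sum_pos U_pos) auto
  have "((\<lambda>s. - ln (\<Sum>k<N. U s k) / \<beta>) has_real_derivative
     - ((\<Sum>k<N. U s k * (- \<beta> * a s k)) / (\<Sum>k<N. U s k)) / \<beta>) (at s)"
    using Z \<beta> by (auto intro!: derivative_eq_intros DERIV_U)
  also have "- ((\<Sum>k<N. U s k * (- \<beta> * a s k)) / (\<Sum>k<N. U s k)) / \<beta> = m s"
    using \<beta> by (simp add: m_def wavg_def sum_divide_distrib sum_negf)
  also have "(\<lambda>s. - ln (\<Sum>k<N. U s k) / \<beta>) = F"
    by (auto simp: F_def smooth_minmax_def U_def E_def)
  finally show ?thesis .
qed

lemma m'_le: "\<bar>m' s\<bar> \<le> 4 * \<beta> * H\<^sup>2"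
proof -
  have "\<bar>avg s (b s)\<bar> \<le> H\<^sup>2" by (intro abs_avg_le b_le)
  moreover have "\<bar>avg s (\<lambda>k. (a s k)\<^sup>2)\<bar> \<le> H\<^sup>2"
    by (intro abs_avg_le abs_power2_le a_le)
  moreover have "\<bar>(m s)\<^sup>2\<bar> \<le> H\<^sup>2" by (intro abs_power2_le m_le)
  ultimately have "\<bar>avg s (b s) - 2 * avg s (\<lambda>k. (a s k)\<^sup>2) + (m s)\<^sup>2\<bar> \<le> 4 * H\<^sup>2" by linarith
  then show ?thesis using \<beta> by (simp add: m'_def abs_mult)
qed

lemma lipschitz_avg:
  assumes "\<And>s k. k < N \<Longrightarrow> ((\<lambda>s. c s k) has_real_derivative c' s k) (at s)"
    and "\<And>s k. k < N \<Longrightarrow> \<bar>c s k\<bar> \<le> B" "\<And>s k. k < N \<Longrightarrow> \<bar>c' s k\<bar> \<le> B'"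
  shows "\<bar>avg s (c s) - avg t (c t)\<bar> \<le> (B' + 2 * \<beta> * H * B) * \<bar>s - t\<bar>"
proof (rule has_real_derivative_imp_lipschitz)
  show "((\<lambda>s. avg s (c s)) has_real_derivative
     avg s (c' s) - \<beta> * (avg s (\<lambda>k. a s k * c s k) - m s * avg s (c s))) (at s)" for s
    by (intro DERIV_avg assms)
  show "\<bar>avg s (c' s) - \<beta> * (avg s (\<lambda>k. a s k * c s k) - m s * avg s (c s))\<bar> \<le> B' + 2 * \<beta> * H * B" for s
  proof -
    have "\<bar>avg s (\<lambda>k. a s k * c s k)\<bar> \<le> H * B" by (intro abs_avg_le abs_mult_le a_le assms)
    moreover have "\<bar>m s * avg s (c s)\<bar> \<le> H * B" by (intro abs_mult_le m_le abs_avg_le assms)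
    ultimately have "\<bar>avg s (\<lambda>k. a s k * c s k) - m s * avg s (c s)\<bar> \<le> 2 * H * B" by linarith
    then have "\<bar>\<beta> * (avg s (\<lambda>k. a s k * c s k) - m s * avg s (c s))\<bar> \<le> \<beta> * (2 * H * B)"
      using \<beta> by (simp add: abs_mult)
    moreover have "\<bar>avg s (c' s)\<bar> \<le> B'" by (intro abs_avg_le assms)
    ultimately show ?thesis by (simp add: algebra_simps)
  qed
qed

lemma lipschitz_m: "\<bar>m s - m t\<bar> \<le> 4 * \<beta> * H\<^sup>2 * \<bar>s - t\<bar>"
  by (rule has_real_derivative_imp_lipschitz[OF DERIV_m m'_le])

lemma lipschitz_m_sq: "\<bar>(m s)\<^sup>2 - (m t)\<^sup>2\<bar> \<le> 8 * \<beta> * H ^ 3 * \<bar>s - t\<bar>"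
  using abs_mult_diff_le[OF lipschitz_m[of s t] lipschitz_m[of s t] m_le[of s] m_le[of t]]
  by (simp add: power2_eq_square power3_eq_cube algebra_simps)

lemma lipschitz_m': "\<bar>m' s - m' t\<bar> \<le> 24 * \<beta>\<^sup>2 * H ^ 3 * \<bar>s - t\<bar>"
proof -
  define X where "X = \<beta> * H ^ 3 * \<bar>s - t\<bar>"
  have "\<bar>avg s (b s) - avg t (b t)\<bar> \<le> (2 * \<beta> * H ^ 3 + 2 * \<beta> * H * H\<^sup>2) * \<bar>s - t\<bar>"
  proof (rule lipschitz_avg[OF DERIV_b b_le])
    fix s k assume k: "k < N"
    have "\<bar>row s k (\<lambda>j. h (k, j) ^ 3)\<bar> \<le> H ^ 3" by (intro abs_row_le abs_h_power_le k)
    moreover have "\<bar>a s k * b s k\<bar> \<le> H * H\<^sup>2" by (intro abs_mult_le a_le b_le k)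
    ultimately have "\<bar>row s k (\<lambda>j. h (k, j) ^ 3) - a s k * b s k\<bar> \<le> 2 * H ^ 3"
      by (simp add: power2_eq_square power3_eq_cube)
    then show "\<bar>\<beta> * (row s k (\<lambda>j. h (k, j) ^ 3) - a s k * b s k)\<bar> \<le> 2 * \<beta> * H ^ 3"
      using \<beta> by (simp add: abs_mult)
  qed
  then have 1: "\<bar>avg s (b s) - avg t (b t)\<bar> \<le> 4 * X"
    by (simp add: X_def power2_eq_square power3_eq_cube algebra_simps)
  have "\<bar>avg s (\<lambda>k. (a s k)\<^sup>2) - avg t (\<lambda>k. (a t k)\<^sup>2)\<bar> \<le> (4 * \<beta> * H ^ 3 + 2 * \<beta> * H * H\<^sup>2) * \<bar>s - t\<bar>"
  proof (rule lipschitz_avg)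
    fix s k assume k: "k < N"
    show "((\<lambda>s. (a s k)\<^sup>2) has_real_derivative 2 * (a s k * (\<beta> * (b s k - (a s k)\<^sup>2)))) (at s)"
      by (auto intro!: derivative_eq_intros DERIV_a)
    show sq: "\<bar>(a s k)\<^sup>2\<bar> \<le> H\<^sup>2" by (intro abs_power2_le a_le k)
    then have "\<bar>b s k - (a s k)\<^sup>2\<bar> \<le> 2 * H\<^sup>2" using b_le[OF k, of s] by linarith
    then have "\<bar>\<beta> * (b s k - (a s k)\<^sup>2)\<bar> \<le> \<beta> * (2 * H\<^sup>2)" using \<beta> by (simp add: abs_mult)
    from abs_mult_le[OF a_le[OF k, of s] this]
    show "\<bar>2 * (a s k * (\<beta> * (b s k - (a s k)\<^sup>2)))\<bar> \<le> 4 * \<beta> * H ^ 3"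
      by (simp add: abs_mult power2_eq_square power3_eq_cube algebra_simps)
  qed
  then have 2: "\<bar>avg s (\<lambda>k. (a s k)\<^sup>2) - avg t (\<lambda>k. (a t k)\<^sup>2)\<bar> \<le> 6 * X"
    by (simp add: X_def power2_eq_square power3_eq_cube algebra_simps)
  have 3: "\<bar>(m s)\<^sup>2 - (m t)\<^sup>2\<bar> \<le> 8 * X"
    using lipschitz_m_sq[of s t] by (simp add: X_def mult.assoc)
  \<comment> \<open>The three Lipschitz bounds combine with the coefficients of \<open>m'\<close>: 4
    + 2 * 6 + 8 = 24.\<close>
  have "m' s - m' t = \<beta> * ((avg s (b s) - avg t (b t))
     - 2 * (avg s (\<lambda>k. (a s k)\<^sup>2) - avg t (\<lambda>k. (a t k)\<^sup>2)) + ((m s)\<^sup>2 - (m t)\<^sup>2))" (is "_ = \<beta> * ?d")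
    by (simp add: m'_def algebra_simps)
  moreover have "\<bar>u - 2 * v + z\<bar> \<le> 24 * X" if "\<bar>u\<bar> \<le> 4 * X" "\<bar>v\<bar> \<le> 6 * X" "\<bar>z\<bar> \<le> 8 * X" for u v z
    using that by linarith
  from this[OF 1 2 3] have "\<bar>?d\<bar> \<le> 24 * X" .
  then have "\<beta> * \<bar>?d\<bar> \<le> \<beta> * (24 * X)" using \<beta> by (intro mult_left_mono) auto
  ultimately show ?thesis
    using \<beta> by (simp add: X_def abs_mult power2_eq_square mult.assoc mult.left_commute)
qed

text \<open>In the Lagrange form the second derivative sits at an intermediate point; comparing it
  with its value at 0 needs only Lipschitz bounds, so no third derivative is taken. The coefficient
  12 is 8 from varying \<open>(m s)\<^sup>2\<close> plus 4 from varying \<open>g'\<close>.\<close>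

lemma Taylor_compose:
  fixes g g' g'' :: "real \<Rightarrow> real"
  assumes g: "\<And>y. (g has_real_derivative g' y) (at y)" "\<And>y. (g' has_real_derivative g'' y) (at y)"
    and G1: "\<And>y. \<bar>g' y\<bar> \<le> G1" and G2: "\<And>y. \<bar>g'' y\<bar> \<le> G2"
    and G3: "\<And>y z. \<bar>g'' y - g'' z\<bar> \<le> G3 * \<bar>y - z\<bar>"
  shows "\<bar>g (F 1) - (g (F 0) + g' (F 0) * m 0 + (g'' (F 0) * (m 0)\<^sup>2 + g' (F 0) * m' 0) / 2)\<bar>
    \<le> (G3 + 12 * \<beta> * G2 + 24 * \<beta>\<^sup>2 * G1) / 2 * H ^ 3"
proof -
  define d2 where "d2 s = g'' (F s) * (m s)\<^sup>2 + g' (F s) * m' s" for s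
  let ?diff = "\<lambda>n::nat. if n = 0 then \<lambda>s. g (F s) else if n = 1 then \<lambda>s. g' (F s) * m s else d2"
  have der: "((\<lambda>s. g (F s)) has_real_derivative g' (F s) * m s) (at s)"
    "((\<lambda>s. g' (F s) * m s) has_real_derivative d2 s) (at s)" for s
    using DERIV_chain2[OF g(1) DERIV_F] DERIV_mult[OF DERIV_chain2[OF g(2) DERIV_F] DERIV_m]
    by (auto simp: d2_def power2_eq_square algebra_simps)
  have "\<exists>t::real. 0 < t \<and> t < 1 \<and>
      g (F 1) = (\<Sum>n<2. ?diff n 0 / fact n * 1 ^ n) + ?diff 2 t / fact 2 * 1 ^ 2"
    by (rule Maclaurin) (use der in \<open>auto simp: less_2_cases_iff\<close>)
  then obtain t where t: "0 < t" "t < 1" and T: "g (F 1) = g (F 0) + g' (F 0) * m 0 + d2 t / 2"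
    by (auto simp: numeral_2_eq_2)
  have lipF: "\<bar>F t - F 0\<bar> \<le> H * \<bar>t - 0\<bar>"
    by (rule has_real_derivative_imp_lipschitz[OF DERIV_F m_le])
  have G: "G1 \<ge> 0" "G2 \<ge> 0" "G3 \<ge> 0" using G1[of 0] G2[of 0] G3[of 1 0] by auto
  have H3: "H ^ 3 \<ge> 0" using H_nonneg by simp
  have "\<bar>g'' (F t) - g'' (F 0)\<bar> \<le> G3 * (H * \<bar>t - 0\<bar>)"
    using G3[of "F t" "F 0"] mult_left_mono[OF lipF G(3)] by linarith
  from abs_mult_diff_le[OF this lipschitz_m_sq[of t 0] G2, of "H\<^sup>2"]
  have 1: "\<bar>g'' (F t) * (m t)\<^sup>2 - g'' (F 0) * (m 0)\<^sup>2\<bar>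
     \<le> G2 * (8 * \<beta> * H ^ 3 * \<bar>t - 0\<bar>) + G3 * (H * \<bar>t - 0\<bar>) * H\<^sup>2"
    using abs_power2_le[OF m_le[of 0]] by simp
  have "\<bar>g' (F t) - g' (F 0)\<bar> \<le> G2 * (H * \<bar>t - 0\<bar>)"
    using has_real_derivative_imp_lipschitz[OF g(2) G2, of "F t" "F 0"] mult_left_mono[OF lipF G(2)] by linarith
  from abs_mult_diff_le[OF this lipschitz_m'[of t 0] G1 m'_le]
  have 2: "\<bar>g' (F t) * m' t - g' (F 0) * m' 0\<bar>
     \<le> G1 * (24 * \<beta>\<^sup>2 * H ^ 3 * \<bar>t - 0\<bar>) + G2 * (H * \<bar>t - 0\<bar>) * (4 * \<beta> * H\<^sup>2)" .
  have "\<bar>d2 t - d2 0\<bar> \<le> (G3 + 12 * \<beta> * G2 + 24 * \<beta>\<^sup>2 * G1) * H ^ 3 * t"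
    using 1 2 t unfolding d2_def by (simp add: power2_eq_square power3_eq_cube algebra_simps)
  also have "\<dots> \<le> (G3 + 12 * \<beta> * G2 + 24 * \<beta>\<^sup>2 * G1) * H ^ 3 * 1"
    using t G H3 \<beta> by (intro mult_left_mono) auto
  finally show ?thesis
    unfolding T d2_def[symmetric] by (simp add: field_simps)
qed

end

section \<open>Gradient and Hessian in coordinates\<close>

text \<open>Used twice: at a direction \<open>h\<close> it matches the Hessian with the second
  derivative along the line, and at the constant vector 1 it sums the entries of a dominating
  matrix.\<close>

lemma quad_form_mixture:
  fixes q :: "nat \<Rightarrow> real" and P h :: "nat \<times> nat \<Rightarrow> real"
  defines "w \<equiv> \<lambda>u. q (fst u) * P u"
  shows "quad_form (mat_idx N p) (\<lambda>u v. \<alpha> * (w u * w v) + \<gamma> * (of_bool (u = v) * w u)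
        + \<kappa> * (of_bool (fst u = fst v) * (w u * P v))) h
    = \<alpha> * (\<Sum>k<N. q k * (\<Sum>j<p. P (k, j) * h (k, j)))\<^sup>2
      + \<gamma> * (\<Sum>k<N. q k * (\<Sum>j<p. P (k, j) * (h (k, j))\<^sup>2))
      + \<kappa> * (\<Sum>k<N. q k * (\<Sum>j<p. P (k, j) * h (k, j))\<^sup>2)"
proof -
  have sum_idx: "(\<Sum>u\<in>mat_idx N p. f u) = (\<Sum>k<N. \<Sum>j<p. f (k, j))" for f :: "nat \<times> nat \<Rightarrow> real"
    by (simp add: mat_idx_def sum.cartesian_product)
  have fin: "finite (mat_idx N p)" by (simp add: mat_idx_def)
  have "(\<Sum>u\<in>mat_idx N p. \<Sum>v\<in>mat_idx N p. h u * h v * (w u * w v)) = (\<Sum>u\<in>mat_idx N p. w u * h u)\<^sup>2"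
    by (simp add: power2_eq_square sum_product ac_simps)
  also have "(\<Sum>u\<in>mat_idx N p. w u * h u) = (\<Sum>k<N. q k * (\<Sum>j<p. P (k, j) * h (k, j)))"
    by (simp add: sum_idx w_def sum_distrib_left mult.assoc)
  finally have 1: "(\<Sum>u\<in>mat_idx N p. \<Sum>v\<in>mat_idx N p. h u * h v * (w u * w v))
    = (\<Sum>k<N. q k * (\<Sum>j<p. P (k, j) * h (k, j)))\<^sup>2" .
  have "(\<Sum>u\<in>mat_idx N p. \<Sum>v\<in>mat_idx N p. h u * h v * (of_bool (u = v) * w u))
     = (\<Sum>u\<in>mat_idx N p. \<Sum>v\<in>mat_idx N p. if v = u then w u * (h u)\<^sup>2 else 0)"
    by (intro sum.cong refl) (auto simp: power2_eq_square)
  also have "\<dots> = (\<Sum>u\<in>mat_idx N p. w u * (h u)\<^sup>2)"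
    using fin by (intro sum.cong refl) simp
  also have "\<dots> = (\<Sum>k<N. q k * (\<Sum>j<p. P (k, j) * (h (k, j))\<^sup>2))"
    by (simp add: sum_idx w_def sum_distrib_left mult.assoc)
  finally have 2: "(\<Sum>u\<in>mat_idx N p. \<Sum>v\<in>mat_idx N p. h u * h v * (of_bool (u = v) * w u))
     = (\<Sum>k<N. q k * (\<Sum>j<p. P (k, j) * (h (k, j))\<^sup>2))" .
  have "(\<Sum>v\<in>mat_idx N p. h (k, j) * h v * (of_bool (k = fst v) * (w (k, j) * P v)))
     = h (k, j) * w (k, j) * (\<Sum>j'<p. P (k, j') * h (k, j'))" if "k < N" for k j
  proof -
    have "(\<Sum>v\<in>mat_idx N p. h (k, j) * h v * (of_bool (k = fst v) * (w (k, j) * P v)))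
      = (\<Sum>k'<N. if k' = k then h (k, j) * w (k, j) * (\<Sum>j'<p. P (k, j') * h (k, j')) else 0)"
      unfolding sum_idx by (intro sum.cong refl) (auto simp: sum_distrib_left ac_simps)
    then show ?thesis using that by simp
  qed
  then have "(\<Sum>u\<in>mat_idx N p. \<Sum>v\<in>mat_idx N p. h u * h v * (of_bool (fst u = fst v) * (w u * P v)))
     = (\<Sum>k<N. \<Sum>j<p. h (k, j) * w (k, j) * (\<Sum>j'<p. P (k, j') * h (k, j')))"
    by (simp add: sum_idx[of "\<lambda>u. \<Sum>v\<in>mat_idx N p. f u v" for f])
  also have "\<dots> = (\<Sum>k<N. q k * (\<Sum>j<p. P (k, j) * h (k, j))\<^sup>2)"
    by (simp add: w_def power2_eq_square sum_distrib_left sum_distrib_right ac_simps)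
  finally have 3: "(\<Sum>u\<in>mat_idx N p. \<Sum>v\<in>mat_idx N p. h u * h v * (of_bool (fst u = fst v) * (w u * P v)))
     = (\<Sum>k<N. q k * (\<Sum>j<p. P (k, j) * h (k, j))\<^sup>2)" .
  have "h u * h v * (\<alpha> * (w u * w v) + \<gamma> * (of_bool (u = v) * w u) + \<kappa> * (of_bool (fst u = fst v) * (w u * P v)))
    = \<alpha> * (h u * h v * (w u * w v)) + \<gamma> * (h u * h v * (of_bool (u = v) * w u))
      + \<kappa> * (h u * h v * (of_bool (fst u = fst v) * (w u * P v)))" for u v
    by (simp only: distrib_left mult.left_commute)
  then show ?thesis
    by (simp only: sum.distrib sum_distrib_left[symmetric] 1 2 3)
qed

lemma smooth_minmax_Taylor:
  fixes g g' g'' :: "real \<Rightarrow> real"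
  assumes N: "N > 0" and p: "p > 0" and \<beta>: "\<beta> > 0"
    and g: "\<And>y. (g has_real_derivative g' y) (at y)" "\<And>y. (g' has_real_derivative g'' y) (at y)"
    and G1: "\<And>y. \<bar>g' y\<bar> \<le> G1" and G2: "\<And>y. \<bar>g'' y\<bar> \<le> G2"
    and G3: "\<And>y z. \<bar>g'' y - g'' z\<bar> \<le> G3 * \<bar>y - z\<bar>"
  shows "\<exists>k l c. (\<Sum>u\<in>mat_idx N p. \<Sum>v\<in>mat_idx N p. \<bar>c u v\<bar>) \<le> G2 + 4 * \<beta> * G1 \<and>
    (\<forall>h. \<bar>g (smooth_minmax N p \<beta> (\<lambda>i\<in>mat_idx N p. x i + h i))
        - (k + lin_form (mat_idx N p) l h + quad_form (mat_idx N p) c h / 2)\<bar>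
      \<le> (G3 + 12 * \<beta> * G2 + 24 * \<beta>\<^sup>2 * G1) / 2 * (\<Sum>i\<in>mat_idx N p. \<bar>h i\<bar> ^ 3))"
proof -
  let ?I = "mat_idx N p"
  define P where "P u = norm_weight {..<p} (\<lambda>j. exp (\<beta> * x (fst u, j))) (snd u)" for u
  define q where "q = norm_weight {..<N} (\<lambda>k. 1 / (\<Sum>j<p. exp (\<beta> * x (k, j))))"
  define w where "w u = q (fst u) * P u" for u
  define F0 where "F0 = smooth_minmax N p \<beta> x"
  \<comment> \<open>Read off from \<open>g'' * m\<^sup>2 + g' * m'\<close>: the squared mean has
    coefficient \<open>g'' + \<beta> * g'\<close>, the mean of squares \<open>\<beta> * g'\<close>,
    and the averaged squared row means \<open>- 2 * \<beta> * g'\<close>.\<close>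
  define c where "c u v = (g'' F0 + \<beta> * g' F0) * (w u * w v) + \<beta> * g' F0 * (of_bool (u = v) * w u)
     + - 2 * \<beta> * g' F0 * (of_bool (fst u = fst v) * (w u * P v))" for u v
  have E: "(\<Sum>j<p. exp (\<beta> * x (k, j))) > 0" for k using p by (intro sum_pos) auto
  have P: "P u \<ge> 0" for u using E[of "fst u"] by (simp add: P_def less_imp_le)
  have q: "q k \<ge> 0" for k unfolding q_def using E
    by (intro divide_nonneg_nonneg sum_nonneg) (auto simp: less_imp_le)
  have w: "w u \<ge> 0" for u using P q by (simp add: w_def)
  have sum_P: "(\<Sum>j<p. P (k, j)) = 1" for k
    using sum_norm_weight[of "{..<p}" "\<lambda>j. exp (\<beta> * x (k, j))"] p by (auto simp: P_def)
  have sum_q: "(\<Sum>k<N. q k) = 1"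
    unfolding q_def using N E by (intro sum_norm_weight) auto
  have G: "G1 \<ge> 0" "G2 \<ge> 0" "G3 \<ge> 0" using G1[of 0] G2[of 0] G3[of 1 0] by auto
  \<comment> \<open>The weights are nonnegative, so absolute values fall on the three coefficients
    only. At the constant vector 1 each average equals 1, and the total is independent of
    \<open>N\<close> and \<open>p\<close>.\<close>
  have "(\<Sum>u\<in>?I. \<Sum>v\<in>?I. \<bar>c u v\<bar>) \<le>
     quad_form ?I (\<lambda>u v. (G2 + \<beta> * G1) * (w u * w v) + \<beta> * G1 * (of_bool (u = v) * w u)
        + 2 * \<beta> * G1 * (of_bool (fst u = fst v) * (w u * P v))) (\<lambda>_. 1)"
  proof (intro sum_mono)
    fix u v
    have "\<bar>g'' F0 + \<beta> * g' F0\<bar> \<le> G2 + \<beta> * G1"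
      using G1[of F0] G2[of F0] \<beta> by (intro order_trans[OF abs_triangle_ineq] add_mono) (auto simp: abs_mult)
    moreover have "\<bar>\<beta> * g' F0\<bar> \<le> \<beta> * G1" "\<bar>- 2 * \<beta> * g' F0\<bar> \<le> 2 * \<beta> * G1"
      using G1[of F0] \<beta> by (auto simp: abs_mult)
    ultimately have "\<bar>c u v\<bar> \<le> (G2 + \<beta> * G1) * \<bar>w u * w v\<bar> + \<beta> * G1 * \<bar>of_bool (u = v) * w u\<bar>
        + 2 * \<beta> * G1 * \<bar>of_bool (fst u = fst v) * (w u * P v)\<bar>"
      unfolding c_def
      by (intro order_trans[OF abs_triangle_ineq] add_mono) (simp_all only: abs_mult mult_right_mono abs_ge_zero mult_nonneg_nonneg)
    then show "\<bar>c u v\<bar> \<le> 1 * 1 * ((G2 + \<beta> * G1) * (w u * w v) + \<beta> * G1 * (of_bool (u = v) * w u)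
        + 2 * \<beta> * G1 * (of_bool (fst u = fst v) * (w u * P v)))"
      using w P by simp
  qed
  also have "\<dots> = G2 + 4 * \<beta> * G1"
    unfolding w_def quad_form_mixture[where h = "\<lambda>_. 1" and q = q and P = P] by (simp add: sum_P sum_q)
  finally have K: "(\<Sum>u\<in>?I. \<Sum>v\<in>?I. \<bar>c u v\<bar>) \<le> G2 + 4 * \<beta> * G1" .
  have "\<bar>g (smooth_minmax N p \<beta> (\<lambda>i\<in>?I. x i + h i))
        - (g F0 + lin_form ?I (\<lambda>u. g' F0 * w u) h + quad_form ?I c h / 2)\<bar>
      \<le> (G3 + 12 * \<beta> * G2 + 24 * \<beta>\<^sup>2 * G1) / 2 * (\<Sum>i\<in>?I. \<bar>h i\<bar> ^ 3)" for h
  proof -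
    have I: "finite ?I" "?I \<noteq> {}" using N p by (auto simp: mat_idx_def)
    \<comment> \<open>The maximum is attained, so \<open>H ^ 3\<close> is one summand of the cubic
      sum required by the comparison theorem.\<close>
    define H where "H = Max ((\<lambda>i. \<bar>h i\<bar>) ` ?I)"
    have "H \<in> (\<lambda>i. \<bar>h i\<bar>) ` ?I" unfolding H_def using I by (intro Max_in) auto
    then obtain u where u: "u \<in> ?I" "H = \<bar>h u\<bar>" by auto
    have H3: "H ^ 3 \<le> (\<Sum>i\<in>?I. \<bar>h i\<bar> ^ 3)"
      unfolding u(2) using I u(1) by (intro member_le_sum) auto
    interpret minmax_line N p \<beta> H x h
      using N p \<beta> I by unfold_locales (auto simp: H_def mat_idx_def intro!: Max_ge)
    have EU: "E 0 k = (\<lambda>j. exp (\<beta> * x (k, j)))" "U 0 = (\<lambda>k. 1 / (\<Sum>j<p. exp (\<beta> * x (k, j))))" for k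
      by (auto simp: E_def U_def)
    have a0: "a 0 k = (\<Sum>j<p. P (k, j) * h (k, j))" and b0: "b 0 k = (\<Sum>j<p. P (k, j) * (h (k, j))\<^sup>2)" for k
      by (simp_all add: a_def b_def wavg_def EU P_def)
    have avg0: "avg 0 d = (\<Sum>k<N. q k * d k)" for d
      by (simp add: wavg_def EU q_def)
    have m0: "m 0 = (\<Sum>k<N. q k * (\<Sum>j<p. P (k, j) * h (k, j)))"
      by (simp add: m_def avg0 a0)
    have "lin_form ?I (\<lambda>u. g' F0 * w u) h = g' F0 * m 0"
      unfolding m0 mat_idx_def
      by (simp add: w_def sum_distrib_left sum.cartesian_product' mult.assoc)
    moreover have "quad_form ?I c h = g'' F0 * (m 0)\<^sup>2 + g' F0 * m' 0"
      unfolding c_def w_def quad_form_mixture m0[symmetric]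
      by (simp add: m'_def avg0 a0 b0 algebra_simps)
    moreover have "F 0 = F0" by (simp add: F_def F0_def)
    moreover have "F 1 = smooth_minmax N p \<beta> (\<lambda>i\<in>?I. x i + h i)"
      by (simp add: F_def smooth_minmax_def mat_idx_def)
    ultimately have "\<bar>g (smooth_minmax N p \<beta> (\<lambda>i\<in>?I. x i + h i))
        - (g F0 + lin_form ?I (\<lambda>u. g' F0 * w u) h + quad_form ?I c h / 2)\<bar>
      \<le> (G3 + 12 * \<beta> * G2 + 24 * \<beta>\<^sup>2 * G1) / 2 * H ^ 3"
      using Taylor_compose[OF g G1 G2 G3] by simp
    also have "\<dots> \<le> (G3 + 12 * \<beta> * G2 + 24 * \<beta>\<^sup>2 * G1) / 2 * (\<Sum>i\<in>?I. \<bar>h i\<bar> ^ 3)"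
      using G \<beta> by (intro mult_left_mono H3) auto
    finally show ?thesis .
  qed
  with K show ?thesis by (intro exI conjI allI)
qed

section \<open>The comparison theorem\<close>

lemma measurable_smooth_minmax [measurable]:
  "smooth_minmax N p \<beta> \<in> borel_measurable (PiM (mat_idx N p) (\<lambda>_. borel))"
proof -
  have [measurable]: "(\<lambda>x. x (k, j)) \<in> borel_measurable (PiM (mat_idx N p) (\<lambda>_. borel))"
    if "k \<in> {..<N}" "j \<in> {..<p}" for k j
    using that by (intro measurable_component_singleton) (auto simp: mat_idx_def)
  show ?thesis unfolding smooth_minmax_def by measurable
qed

lemma measurable_minmax_stat [measurable]:
  "minmax_stat N p \<in> borel_measurable (PiM (mat_idx N p) (\<lambda>_. borel))"
proof -
  have [measurable]: "(\<lambda>x. x (k, j)) \<in> borel_measurable (PiM (mat_idx N p) (\<lambda>_. borel))"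
    if "k \<in> {..<N}" "j \<in> {..<p}" for k j
    using that by (intro measurable_component_singleton) (auto simp: mat_idx_def)
  show ?thesis unfolding minmax_stat_def
    by (intro borel_measurable_Min borel_measurable_Max) auto
qed

lemma closed_enlarge: "closed (enlarge A \<epsilon>)"
proof (cases "A = {}")
  case False
  have "closed {t. infdist t A \<le> \<epsilon>}"
    by (intro closed_Collect_le continuous_intros)
  with False show ?thesis by (simp add: enlarge_def)
qed (simp add: enlarge_def)

lemma cov_sup_dist_ge:
  assumes "u \<in> mat_idx N p" "v \<in> mat_idx N p"
  shows "\<bar>S u v - R u v\<bar> \<le> cov_sup_dist N p S R"
  unfolding cov_sup_dist_def
  by (rule Max_ge) (use assms in \<open>auto simp: mat_idx_def intro!: image_eqI[where x="(u, v)"]\<close>)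

lemma measure_eq_integral_indicator:
  "measure M {x \<in> space M. f x \<in> B} = (\<integral>x. indicat_real B (f x) \<partial>M)"
proof -
  have "(\<integral>x. indicat_real B (f x) \<partial>M) = (\<integral>x. indicat_real {x \<in> space M. f x \<in> B} x \<partial>M)"
    by (intro Bochner_Integration.integral_cong) (auto simp: indicator_def)
  also have "\<dots> = measure M ({x \<in> space M. f x \<in> B} \<inter> space M)" by simp
  also have "{x \<in> space M. f x \<in> B} \<inter> space M = {x \<in> space M. f x \<in> B}" by auto
  finally show ?thesis ..
qed

theorem minmax_gaussian_comparison:
  assumes Np: "N * p \<ge> 2" and PX: "gaussian_law (mat_idx N p) PX mu SX" and PY: "gaussian_law (mat_idx N p) PY mu SY"
    and \<delta>: "\<delta> > 0" and [measurable]: "A \<in> sets borel"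
  shows "measure PX {x \<in> space PX. minmax_stat N p x \<in> A}
     \<le> measure PY {y \<in> space PY. minmax_stat N p y \<in> enlarge A (5 * \<delta>)}
       + 4 * \<delta> powi (-2) * cov_sup_dist N p SX SY * ln (real (N * p))"
proof -
  have N: "N > 0" and p: "p > 0" using Np by (auto intro!: Nat.gr0I)
  define D where "D = cov_sup_dist N p SX SY"
  define \<Lambda> where "\<Lambda> = ln (real (N * p))"
  have "ln 2 \<le> \<Lambda>" unfolding \<Lambda>_def using Np by (intro ln_mono) (auto simp flip: of_nat_mult)
  then have \<Lambda>: "1 / 2 \<le> \<Lambda>" using ln2_ge_two_thirds by simp
  have D: "D \<ge> 0"
    using cov_sup_dist_ge[of "(0, 0)" N p "(0, 0)" SX SY] N p by (auto simp: D_def mat_idx_def)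
  show ?thesis
  \<comment> \<open>\<open>infdist\<close> to the empty set is 0 by convention, so the cutoff would
    be 1 everywhere; here both probabilities vanish and the error term is nonnegative.\<close>
  proof (cases "A = {}")
    case True
    then show ?thesis
      unfolding D_def[symmetric] \<Lambda>_def[symmetric] using D \<Lambda> \<delta> by (simp add: enlarge_def)
  next
    case False
    obtain g g' g'' where g: "\<And>x. (g has_real_derivative g' x) (at x)" "\<And>x. (g' has_real_derivative g'' x) (at x)"
      and g_bd: "\<And>x. 0 \<le> g x" "\<And>x. g x \<le> 1"
      and g1: "\<And>x. infdist x A \<le> \<delta> \<Longrightarrow> g x = 1" and g0: "\<And>x. infdist x A \<ge> 4 * \<delta> \<Longrightarrow> g x = 0"
      and G1: "\<And>x. \<bar>g' x\<bar> \<le> 1 / \<delta>" and G2: "\<And>x. \<bar>g'' x\<bar> \<le> 2 / \<delta>\<^sup>2"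
      and G3: "\<And>x y. \<bar>g'' x - g'' y\<bar> \<le> 4 / \<delta> ^ 3 * \<bar>x - y\<bar>"
      by (rule ex_smooth_cutoff[OF False \<delta>], rule that) assumption+
    define \<beta> where "\<beta> = \<Lambda> / \<delta>"
    have \<beta>: "\<beta> > 0" using \<Lambda> \<delta> by (simp add: \<beta>_def)
    have close: "\<bar>smooth_minmax N p \<beta> x - minmax_stat N p x\<bar> \<le> \<delta>" for x
      using smooth_minmax_bounds[OF N p \<beta>, of x] \<Lambda> \<delta> by (simp add: \<beta>_def \<Lambda>_def)
    have id: "\<bar>infdist (smooth_minmax N p \<beta> x) A - infdist (minmax_stat N p x) A\<bar> \<le> \<delta>" for x
      using infdist_triangle_abs[of "smooth_minmax N p \<beta> x" A "minmax_stat N p x"] close[of x]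
      by (simp add: dist_real_def)
    define f where "f x = g (smooth_minmax N p \<beta> x)" for x
    have "continuous_on UNIV g"
      using g(1) by (intro continuous_at_imp_continuous_on ballI DERIV_isCont) auto
    then have [measurable]: "g \<in> borel_measurable borel" by (rule borel_measurable_continuous_onI)
    have f[measurable]: "f \<in> borel_measurable (PiM (mat_idx N p) (\<lambda>_. borel))"
      unfolding f_def by measurable
    have [measurable_cong]: "sets PX = sets (PiM (mat_idx N p) (\<lambda>_. borel))"
      "sets PY = sets (PiM (mat_idx N p) (\<lambda>_. borel))"
      using PX PY by (simp_all add: gaussian_law_def)
    interpret X: prob_space PX using PX by (simp add: gaussian_law_def)
    interpret Y: prob_space PY using PY by (simp add: gaussian_law_def)
    have [measurable]: "enlarge A (5 * \<delta>) \<in> sets borel" by (intro borel_closed closed_enlarge)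
    have f_bd: "0 \<le> f x" "f x \<le> 1" for x using g_bd by (simp_all add: f_def)
    have "measure PX {x \<in> space PX. minmax_stat N p x \<in> A} = (\<integral>x. indicator A (minmax_stat N p x) \<partial>PX)"
      by (rule measure_eq_integral_indicator)
    also have "\<dots> \<le> (\<integral>x. f x \<partial>PX)"
    proof (intro integral_mono)
      show "integrable PX (\<lambda>x. indicator A (minmax_stat N p x) :: real)"
        by (intro X.integrable_const_bound[of _ 1]) (auto simp: indicator_def)
      show "integrable PX f"
        using f_bd by (intro X.integrable_const_bound[of _ 1]) auto
      show "indicator A (minmax_stat N p x) \<le> f x" for x
        using id[of x] f_bd(1)[of x] g1[of "smooth_minmax N p \<beta> x"] by (auto simp: f_def indicator_def)
    qed
    also have "\<dots> \<le> (\<integral>x. f x \<partial>PY) + (2 / \<delta>\<^sup>2 + 4 * \<beta> * (1 / \<delta>)) * D / 2"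
    proof -
      have "\<bar>(\<integral>x. f x \<partial>PX) - (\<integral>x. f x \<partial>PY)\<bar> \<le> (2 / \<delta>\<^sup>2 + 4 * \<beta> * (1 / \<delta>)) * D / 2"
      proof (rule gaussian_comparison[OF _ PX PY f])
        show "\<bar>f x\<bar> \<le> 1" for x using f_bd by simp
        show "\<bar>SX u v - SY u v\<bar> \<le> D" if "u \<in> mat_idx N p" "v \<in> mat_idx N p" for u v
          using cov_sup_dist_ge that by (simp add: D_def)
        show "finite (mat_idx N p)" by (simp add: mat_idx_def)
      qed (unfold f_def, rule smooth_minmax_Taylor[OF N p \<beta> g G1 G2 G3], rule D)
      then show ?thesis by linarith
    qed
    also have "(\<integral>x. f x \<partial>PY) \<le> (\<integral>y. indicator (enlarge A (5 * \<delta>)) (minmax_stat N p y) \<partial>PY)"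
    proof (intro integral_mono)
      show "integrable PY (\<lambda>x. indicator (enlarge A (5 * \<delta>)) (minmax_stat N p x) :: real)"
        by (intro Y.integrable_const_bound[of _ 1]) (auto simp: indicator_def)
      show "integrable PY f"
        using f_bd by (intro Y.integrable_const_bound[of _ 1]) auto
      show "f x \<le> indicator (enlarge A (5 * \<delta>)) (minmax_stat N p x)" for x
        using id[of x] f_bd(2)[of x] False g0[of "smooth_minmax N p \<beta> x"]
        by (auto simp: f_def indicator_def enlarge_def)
    qed
    also have "(\<integral>y. indicator (enlarge A (5 * \<delta>)) (minmax_stat N p y) \<partial>PY)
       = measure PY {y \<in> space PY. minmax_stat N p y \<in> enlarge A (5 * \<delta>)}"
      by (rule measure_eq_integral_indicator[symmetric])
    also have "(2 / \<delta>\<^sup>2 + 4 * \<beta> * (1 / \<delta>)) * D / 2 = (1 + 2 * \<Lambda>) * (D / \<delta>\<^sup>2)"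
      using \<delta> by (simp add: \<beta>_def field_simps power2_eq_square)
    \<comment> \<open>The summand 1 comes from \<open>g''\<close> and is at most
      \<open>2 * \<Lambda>\<close>, because \<open>N * p \<ge> 2\<close> gives
      \<open>\<Lambda> \<ge> 1 / 2\<close>; hence the constant 4.\<close>
    also have "\<dots> \<le> (4 * \<Lambda>) * (D / \<delta>\<^sup>2)"
      using \<Lambda> D by (intro mult_right_mono) auto
    also have "\<dots> = 4 * \<delta> powi (-2) * D * \<Lambda>"
      by (simp add: power_int_minus divide_inverse)
    finally show ?thesis by (simp add: D_def \<Lambda>_def)
  qed
qed

theorem theorem6p4:
  "\<exists>C > (0::real). \<forall>N p mu SigmaX SigmaY PX PY delta A.
     N * p \<ge> 2 \<longrightarrow>
     gaussian_law (mat_idx N p) PX mu SigmaX \<longrightarrow>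
     gaussian_law (mat_idx N p) PY mu SigmaY \<longrightarrow>
     delta > 0 \<longrightarrow> A \<in> sets borel \<longrightarrow>
     measure PX {x \<in> space PX. minmax_stat N p x \<in> A}
       \<le> measure PY {y \<in> space PY. minmax_stat N p y \<in> enlarge A (5 * delta)}
         + C * delta powi (-2) * cov_sup_dist N p SigmaX SigmaY * ln (real (N * p))"
  using minmax_gaussian_comparison by (intro exI[of _ 4]) simp

end
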